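(* Let $\alpha\ge 0$ and $1<p\le q<\infty$. Let $\sigma,a,b\in\mathbf R$ satisfy $0<\sigma<\alpha+1$, $a<(\alpha+1)/p'$, $b<(\alpha+1)/q$, $a+b\ge 0$, where $1/p+1/p'=1$, and $$\frac1q=\frac1p-\frac{\sigma-a-b}{\alpha+1}.$$ Then there is a constant $C$, independent of $f$, such that $$\|I_\sigma f\|_{L^q_{v(\alpha-bq)}}\le C\,\|f\|_{L^p_{v(\alpha+ap)}}\qquad\text{for all } f\in E,$$ where $I_\sigma$ is the Laguerre fractional integral operator of order $\sigma$ (with parameter $\alpha$).
   Context: For $\gamma>-1$ and $1\le p<\infty$, $\|f\|_{L^p_{v(\gamma)}}=\big(\int_0^\infty |f(x)|^p x^\gamma\,dx\big)^{1/p}$. Let $L_k^\alpha$ denote the classical Laguerre polynomial of degree $k$ and order $\alpha>-1$, and set $$l_k^\alpha(x)=\Big(\frac{k!}{\Gamma(k+\alpha+1)}\Big)^{1/2}e^{-x/2}L_k^\alpha(x),\qquad k\in\mathbf N_0,\ x\geq 0;$$ this is an orthonormal basis of $L^2((0,\infty),x^\alpha dx)$. $E$ is the vector space of functions on $[0,\infty)$ of the form $f(x)=p(x)e^{-x/2}$ with $p$ a polynomial. For $f\in E$ put $a_k=\int_0^\infty f(x)l_k^\alpha(x)x^\alpha\,dx$ (only finitely many $a_k$ are nonzero). The fractional integral operator is $$I_\sigma f(x)=\sum_{k=0}^\infty (k+1)^{-\sigma}a_k\,l_k^\alpha(x),\qquad f\in E.$$ *)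

theory Defs
  imports "HOL-Analysis.Analysis"
begin

(* Functions on [0,oo) are modelled as functions on real; their values at negative
   arguments are never used. *)

(* The norm of L^p((0,oo), x^c dx), with values in [0,oo]. *)
definition Lp_weight_norm :: "real \<Rightarrow> real \<Rightarrow> (real \<Rightarrow> complex) \<Rightarrow> ennreal" where
  "Lp_weight_norm p c f =
     (let J = (\<integral>\<^sup>+x\<in>{0<..}. ennreal (norm (f x) powr p * x powr c) \<partial>lborel)
      in if J = \<infinity> then \<infinity> else ennreal (enn2real J powr (1 / p)))"

definition laguerre :: "real \<Rightarrow> nat \<Rightarrow> real \<Rightarrow> real" where
  "laguerre \<alpha> k x = (\<Sum>i\<le>k. (-1) ^ i * ((real k + \<alpha>) gchoose (k - i)) * x ^ i / fact i)"

definition laguerre_fun :: "real \<Rightarrow> nat \<Rightarrow> real \<Rightarrow> real" where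
  "laguerre_fun \<alpha> k x =
     sqrt (fact k / Gamma (real k + \<alpha> + 1)) * exp (- x / 2) * laguerre \<alpha> k x"

definition laguerre_space :: "(real \<Rightarrow> complex) set" where
  "laguerre_space =
     {f. \<exists>P :: complex poly. \<forall>x\<ge>0. f x = poly P (of_real x) * of_real (exp (- x / 2))}"

definition laguerre_coeff :: "real \<Rightarrow> (real \<Rightarrow> complex) \<Rightarrow> nat \<Rightarrow> complex" where
  "laguerre_coeff \<alpha> f k =
     (LBINT x:{0<..}. f x * of_real (laguerre_fun \<alpha> k x * x powr \<alpha>))"

definition laguerre_frac_int :: "real \<Rightarrow> real \<Rightarrow> (real \<Rightarrow> complex) \<Rightarrow> real \<Rightarrow> complex" where
  "laguerre_frac_int \<alpha> \<sigma> f x =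
     (\<Sum>k. of_real ((real k + 1) powr (- \<sigma>)) * laguerre_coeff \<alpha> f k *
            of_real (laguerre_fun \<alpha> k x))"

end

(* The identity (k+1)^(-sigma) = 1/Gamma(sigma) * integral of t^(sigma-1) e^(-t) e^(-kt) dt turns
   I_sigma into an average over r = e^(-t) of the Laguerre-Poisson semigroup, whose kernel is the
   positive Hille-Hardy kernel.  On a polynomial times e^(-x/2) this only needs the kernel to act
   correctly on monomials, which is a pair of Vandermonde-type sums; no orthogonality is used.

   Write delta = alpha + 1 - sigma.  Comparing the Bessel series in the Hille-Hardy kernel with the
   exponential series gives, for 0 <= eta <= alpha + 1/2 with eta < delta,
     K(x,y) <= C (xy)^(-eta/2) |sqrt x - sqrt y|^(-2(delta - eta)),
   which is homogeneous of degree -delta.  With respect to dx/x the weighted operator is therefore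
   dominated by a multiplicative convolution whose kernel decays at 0 and infinity, because
   a < (alpha+1)/p' and b < (alpha+1)/q, and has a singularity |1 - u|^(-theta) at u = 1 for any
   theta > max 0 (1 - 2 sigma), theta <= 2 delta.  Let 1/r = 1 + 1/q - 1/p.  Since a + b >= 0 and
   alpha >= 0, 1/r >= 1 - sigma, so theta < 1/r can be chosen, the kernel lies in L^r, and the
   classical (strong) Young inequality is enough. *)
theory Submission
  imports Defs
begin

section \<open>Binomial sums for Laguerre polynomials\<close>


text \<open>The power \<eta> is there because \<eta> = 0, the Gaussian factor alone, leaves the
  singularity |1 - u|^(-2 \<delta>), and \<delta> can be large. The decay of the Bessel series
  trades part of it for a power of xy, which is harmless near u = 1. It cannot give more than \<eta>
  = \<alpha> + 1/2, the true decay of z^(-\<alpha>) I_\<alpha>(z) e^(-z). With \<eta> = \<delta> -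
  \<theta>/2 this limit reads \<theta> >= 1 - 2 \<sigma>: in the variable sqrt x the operator
  smooths by 2 \<sigma>, as for a heat semigroup. The scaling relation gives 1 - 1/r = (\<sigma> - a
  - b)/(\<alpha> + 1) <= \<sigma>, so 1/r lies strictly above 1 - 2 \<sigma>. This gap is what
  spares a weak-type estimate. Strict positivity of \<theta> keeps the t-integral of the Gaussian
  bound convergent at infinity; at \<theta> = 0 it would diverge logarithmically. Once the weights
  are absorbed, the kernel is u^\<beta> times the majorant with \<beta> = (\<alpha>+1)/q - b, and
  \<delta> - \<beta> = (\<alpha>+1)/p' - a by scaling: the two strict hypotheses are the decay at
  the two ends.\<close>

text \<open>Trinomial revision, arranged so that on the right k occurs only in an ordinary binomial
  coefficient. Sums over k against powers of -r then fall to the binomial theorem.\<close>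

lemma gbinomial_trinomial_shift:
  fixes \<alpha> :: real
  assumes "j \<le> k" "k \<le> n"
  shows "((real n + \<alpha>) gchoose (n - k)) * ((real k + \<alpha>) gchoose (k - j)) =
         ((real n + \<alpha>) gchoose (n - j)) * real ((n - j) choose (k - j))"
proof -
  have "((real n + \<alpha>) gchoose (n - j)) * (of_nat (n - j) gchoose (n - k)) =
        ((real n + \<alpha>) gchoose (n - k)) * ((real n + \<alpha> - of_nat (n - k)) gchoose (n - j - (n - k)))"
    by (rule gbinomial_trinomial_revision) (use assms in auto)
  moreover have "real n + \<alpha> - of_nat (n - k) = real k + \<alpha>" using assms by (simp add: of_nat_diff)
  moreover have "n - j - (n - k) = k - j" using assms by auto
  moreover have "(n - j) choose (n - k) = (n - j) choose (k - j)"
    using binomial_symmetric[of "k - j" "n - j"] assms by simp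
  ultimately show ?thesis by (simp add: binomial_gbinomial [symmetric] add.commute)
qed

text \<open>At r = 1 the right side is \<open>x ^ n / fact n\<close>, so the left side is the
  Laguerre expansion of this monomial with r^k inserted, that is, the Poisson semigroup applied to
  it. After the sums are exchanged, the sum over k is (1 - r)^(n - j) up to a factor. The right side
  is the form in which the Hille-Hardy kernel produces the same function.\<close>

lemma laguerre_generating_sum:
  fixes \<alpha> r x :: real
  shows "(\<Sum>k\<le>n. (- r) ^ k * ((real n + \<alpha>) gchoose (n - k)) * laguerre \<alpha> k x) =
         (\<Sum>j\<le>n. ((real n + \<alpha>) gchoose (n - j)) * r ^ j * (1 - r) ^ (n - j) * x ^ j / fact j)"
proof -
  have inner: "(\<Sum>k\<in>{j..n}. (- r) ^ k * real ((n - j) choose (k - j))) = (- r) ^ j * (1 - r) ^ (n - j)"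
    if "j \<le> n" for j
  proof -
    have "(\<Sum>k\<in>{j..n}. (- r) ^ k * real ((n - j) choose (k - j))) =
          (\<Sum>m\<le>n - j. (- r) ^ (m + j) * real ((n - j) choose m))"
      by (rule sum.reindex_bij_witness[of _ "\<lambda>m. m + j" "\<lambda>k. k - j"]) (use that in auto)
    also have "\<dots> = (- r) ^ j * (\<Sum>m\<le>n - j. real ((n - j) choose m) * (- r) ^ m * 1 ^ (n - j - m))"
      by (simp add: sum_distrib_left power_add mult_ac)
    also have "\<dots> = (- r) ^ j * (- r + 1) ^ (n - j)"
      by (subst binomial_ring) simp
    finally show ?thesis by simp
  qed
  have "(\<Sum>k\<le>n. (- r) ^ k * ((real n + \<alpha>) gchoose (n - k)) * laguerre \<alpha> k x) =
     (\<Sum>k\<le>n. \<Sum>j\<le>k. (- r) ^ k * (((real n + \<alpha>) gchoose (n - k)) * ((real k + \<alpha>) gchoose (k - j)))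
        * ((- 1) ^ j * x ^ j / fact j))"
    by (simp add: laguerre_def sum_distrib_left mult_ac)
  also have "\<dots> = (\<Sum>k\<le>n. \<Sum>j\<le>k. (- r) ^ k * (((real n + \<alpha>) gchoose (n - j)) * real ((n - j) choose (k - j)))
        * ((- 1) ^ j * x ^ j / fact j))"
    by (intro sum.cong refl) (simp only: gbinomial_trinomial_shift atMost_iff)
  also have "\<dots> = (\<Sum>j\<le>n. \<Sum>k\<in>{j..n}. (- r) ^ k * (((real n + \<alpha>) gchoose (n - j)) * real ((n - j) choose (k - j)))
        * ((- 1) ^ j * x ^ j / fact j))"
    by (subst sum.Sigma, simp, simp, subst sum.Sigma, simp, simp,
        rule sum.reindex_bij_witness[of _ "\<lambda>(j,k). (k,j)" "\<lambda>(k,j). (j,k)"]) auto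
  also have "\<dots> = (\<Sum>j\<le>n. (\<Sum>k\<in>{j..n}. (- r) ^ k * real ((n - j) choose (k - j))) *
        (((real n + \<alpha>) gchoose (n - j)) * ((- 1) ^ j * x ^ j / fact j)))"
    by (simp add: sum_distrib_left sum_distrib_right sum_divide_distrib mult_ac)
  also have "\<dots> = (\<Sum>j\<le>n. ((real n + \<alpha>) gchoose (n - j)) * r ^ j * (1 - r) ^ (n - j) * x ^ j / fact j)"
  proof (intro sum.cong refl)
    fix j assume "j \<in> {..n}"
    moreover have "(- r) ^ j * (- 1) ^ j = r ^ j" by (simp flip: power_mult_distrib)
    ultimately show "(\<Sum>k\<in>{j..n}. (- r) ^ k * real ((n - j) choose (k - j))) *
        (((real n + \<alpha>) gchoose (n - j)) * ((- 1) ^ j * x ^ j / fact j)) =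
        ((real n + \<alpha>) gchoose (n - j)) * r ^ j * (1 - r) ^ (n - j) * x ^ j / fact j"
      by (simp add: inner mult_ac)
  qed
  finally show ?thesis .
qed

text \<open>The Pochhammer symbol is n! times the binomial coefficient of m + (n + \<alpha>) over n,
  and Vandermonde splits it at this sum. The dependence on m is thereby confined to
  \<open>m choose j\<close>, which can be summed both against the exponential series and against
  alternating signs.\<close>

lemma pochhammer_shift_Vandermonde:
  fixes \<alpha> :: real
  shows "pochhammer (real m + \<alpha> + 1) n = fact n * (\<Sum>j\<le>n. real (m choose j) * ((real n + \<alpha>) gchoose (n - j)))"
proof -
  have "(\<Sum>j\<le>n. real (m choose j) * ((real n + \<alpha>) gchoose (n - j))) = (real m + (real n + \<alpha>)) gchoose n"
    using gbinomial_Vandermonde[of "real m" "real n + \<alpha>" n]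
    by (simp add: binomial_gbinomial atMost_atLeast0)
  also have "\<dots> = pochhammer (real m + \<alpha> + 1) n / fact n"
    by (simp add: gbinomial_pochhammer' algebra_simps)
  finally show ?thesis by simp
qed

lemma exp_binomial_sums:
  fixes z :: real
  shows "(\<lambda>m. z ^ m / fact m * real (m choose j)) sums (z ^ j / fact j * exp z)"
proof -
  have "(\<lambda>m. z ^ m /\<^sub>R fact m) sums exp z" by (rule exp_converges)
  hence "(\<lambda>m. z ^ j / fact j * (z ^ m /\<^sub>R fact m)) sums (z ^ j / fact j * exp z)" by (rule sums_mult)
  moreover have "z ^ j / fact j * (z ^ m /\<^sub>R fact m) = z ^ (m + j) / fact (m + j) * real ((m + j) choose j)" for m
    by (simp add: binomial_fact power_add divide_simps scaleR_conv_of_real)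
  ultimately have "(\<lambda>m. z ^ (m + j) / fact (m + j) * real ((m + j) choose j)) sums (z ^ j / fact j * exp z)"
    by simp
  thus ?thesis
    by (subst (asm) sums_iff_shift) (simp add: binomial_eq_0)
qed

text \<open>Kummer's transformation in its terminating case: the left side is a multiple of
  1F1(\<alpha>+n+1; \<alpha>+1; z), and the finite sum on the right is the Laguerre polynomial of
  degree n at -z.\<close>

lemma exp_pochhammer_sums:
  fixes z \<alpha> :: real
  shows "(\<lambda>m. z ^ m / fact m * pochhammer (real m + \<alpha> + 1) n) sums
         (exp z * fact n * (\<Sum>j\<le>n. ((real n + \<alpha>) gchoose (n - j)) * z ^ j / fact j))"
proof -
  have "(\<lambda>m. \<Sum>j\<le>n. fact n * ((real n + \<alpha>) gchoose (n - j)) * (z ^ m / fact m * real (m choose j))) sums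
        (\<Sum>j\<le>n. fact n * ((real n + \<alpha>) gchoose (n - j)) * (z ^ j / fact j * exp z))"
    by (intro sums_sum sums_mult exp_binomial_sums)
  thus ?thesis
    by (simp add: pochhammer_shift_Vandermonde sum_distrib_left mult_ac)
qed

text \<open>Binomial inversion. The product of the two coefficients is \<open>k choose j\<close>
  times \<open>(k - j) choose (i - j)\<close>, and what remains is an alternating row sum, which
  vanishes unless the row is row 0.\<close>

lemma alternating_binomial_product_sum:
  "(\<Sum>i\<le>k. (-1) ^ i * real (k choose i) * real (i choose j)) = (if j = k then (-1) ^ k else 0)"
proof (cases "j \<le> k")
  case True
  have "(\<Sum>i\<le>k. (-1) ^ i * real (k choose i) * real (i choose j)) =
        (\<Sum>i\<in>{j..k}. (-1) ^ i * real (k choose i) * real (i choose j))"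
    by (rule sum.mono_neutral_right) (auto simp: binomial_eq_0)
  also have "\<dots> = (\<Sum>i\<in>{j..k}. (-1) ^ i * (real (k choose j) * real ((k - j) choose (i - j))))"
    by (intro sum.cong refl) (simp add: choose_mult flip: of_nat_mult)
  also have "\<dots> = (\<Sum>m\<le>k - j. (-1) ^ (m + j) * (real (k choose j) * real ((k - j) choose m)))"
    by (rule sum.reindex_bij_witness[of _ "\<lambda>m. m + j" "\<lambda>i. i - j"]) (use True in auto)
  also have "\<dots> = (-1) ^ j * real (k choose j) * (\<Sum>m\<le>k - j. (-1) ^ m * real ((k - j) choose m))"
    by (simp add: sum_distrib_left power_add mult_ac)
  also have "\<dots> = (if j = k then (-1) ^ k else 0)"
    using True choose_alternating_sum[of "k - j", where 'a = real] by auto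
  finally show ?thesis .
qed (auto intro!: sum.neutral simp: binomial_eq_0)

text \<open>Up to sign a k-th finite difference, at 0, of a polynomial of degree n in i. Expanded in
  the basis \<open>i choose j\<close>, only j = k survives, and it is absent when k > n.\<close>

lemma alternating_pochhammer_sum:
  fixes \<alpha> :: real
  shows "(\<Sum>i\<le>k. (-1) ^ i * real (k choose i) * pochhammer (real i + \<alpha> + 1) n) =
         (if k \<le> n then (-1) ^ k * fact n * ((real n + \<alpha>) gchoose (n - k)) else 0)"
proof -
  have "(\<Sum>i\<le>k. (-1) ^ i * real (k choose i) * pochhammer (real i + \<alpha> + 1) n) =
        (\<Sum>i\<le>k. \<Sum>j\<le>n. fact n * ((real n + \<alpha>) gchoose (n - j)) * ((-1) ^ i * real (k choose i) * real (i choose j)))"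
    by (simp add: pochhammer_shift_Vandermonde sum_distrib_left mult_ac)
  also have "\<dots> = (\<Sum>j\<le>n. fact n * ((real n + \<alpha>) gchoose (n - j)) * (\<Sum>i\<le>k. (-1) ^ i * real (k choose i) * real (i choose j)))"
    by (subst sum.swap) (simp add: sum_distrib_left)
  also have "\<dots> = (\<Sum>j\<le>n. if j = k then (-1) ^ k * fact n * ((real n + \<alpha>) gchoose (n - k)) else 0)"
    by (intro sum.cong refl) (simp add: alternating_binomial_product_sum)
  also have "\<dots> = (if k \<le> n then (-1) ^ k * fact n * ((real n + \<alpha>) gchoose (n - k)) else 0)"
    by (simp add: sum.delta)
  finally show ?thesis .
qed

section \<open>The Hille-Hardy kernel\<close>


lemma nn_integral_powr_exp:
  fixes s c :: real
  assumes "s > 0" "c > 0"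
  shows "(\<integral>\<^sup>+y. ennreal (indicator {0<..} y * (y powr (s - 1) * exp (- c * y))) \<partial>lborel) = ennreal (Gamma s / c powr s)"
proof -
  let ?g = "\<lambda>t::real. ennreal (indicator {0<..} t * (t powr (s - 1) * exp (- t)))"
  have "Gamma s = (\<integral>\<^sup>+t. ?g t \<partial>lborel)"
    unfolding Gamma_conv_nn_integral_real[OF assms(1)]
    by (intro nn_integral_cong_AE AE_I[where N = "{0}"]) (auto simp: indicator_def exp_minus field_simps)
  also have "\<dots> = ennreal c * (\<integral>\<^sup>+t. ?g (0 + c * t) \<partial>lborel)"
    using assms by (subst nn_integral_real_affine[of _ c 0]) auto
  also have "(\<integral>\<^sup>+t. ?g (0 + c * t) \<partial>lborel) =
      (\<integral>\<^sup>+y. ennreal (c powr (s - 1)) * ennreal (indicator {0<..} y * (y powr (s - 1) * exp (- c * y))) \<partial>lborel)"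
    using assms by (intro nn_integral_cong)
      (auto simp: indicator_def powr_mult zero_less_mult_iff simp flip: ennreal_mult)
  also have "\<dots> = ennreal (c powr (s - 1)) * (\<integral>\<^sup>+y. ennreal (indicator {0<..} y * (y powr (s - 1) * exp (- c * y))) \<partial>lborel)"
    by (subst nn_integral_cmult) auto
  finally have "ennreal (Gamma s) = ennreal (c powr s) *
      (\<integral>\<^sup>+y. ennreal (indicator {0<..} y * (y powr (s - 1) * exp (- c * y))) \<partial>lborel)"
    using assms by (simp add: powr_diff flip: ennreal_mult mult.assoc)
  hence "ennreal (1 / c powr s) * ennreal (Gamma s) = ennreal (1 / c powr s * c powr s) *
      (\<integral>\<^sup>+y. ennreal (indicator {0<..} y * (y powr (s - 1) * exp (- c * y))) \<partial>lborel)"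
    by (simp only: ennreal_mult' powr_ge_zero mult.assoc ennreal_mult[OF _ powr_ge_zero] divide_nonneg_nonneg zero_le_one)
  thus ?thesis using assms by (simp add: Gamma_real_pos flip: ennreal_mult)
qed

lemma has_bochner_integral_powr_exp:
  fixes s c :: real
  assumes "s > 0" "c > 0"
  shows "has_bochner_integral lborel (\<lambda>y. indicator {0<..} y * (y powr (s - 1) * exp (- c * y))) (Gamma s / c powr s)"
  by (intro has_bochner_integral_nn_integral nn_integral_powr_exp assms)
     (use assms in \<open>auto simp: Gamma_real_pos intro!: divide_nonneg_nonneg less_imp_le\<close>)

text \<open>Equals w^(-\<alpha>/2) I_\<alpha>(2 sqrt w) with the modified Bessel function
  I_\<alpha>. Leaving out the fractional power makes it a power series in w, with no exception at w
  = 0.\<close>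

definition bessel_series :: "real \<Rightarrow> real \<Rightarrow> real" where
  "bessel_series \<alpha> w = (\<Sum>m. w ^ m / (fact m * Gamma (real m + \<alpha> + 1)))"

(* The Hille-Hardy kernel: the sum of r^k l_k(x) l_k(y) over k. *)
definition hille_hardy :: "real \<Rightarrow> real \<Rightarrow> real \<Rightarrow> real \<Rightarrow> real" where
  "hille_hardy \<alpha> r x y =
     (1 - r) powr (- 1 - \<alpha>) * exp (- ((1 + r) / (2 * (1 - r))) * (x + y)) *
     bessel_series \<alpha> (x * y * r / (1 - r)\<^sup>2)"

lemma Gamma_shift_pochhammer:
  fixes \<alpha> :: real
  assumes "\<alpha> > -1"
  shows "Gamma (real m + \<alpha> + 1) = pochhammer (\<alpha> + 1) m * Gamma (\<alpha> + 1)"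
proof -
  have "\<alpha> + 1 \<notin> \<int>\<^sub>\<le>\<^sub>0" using assms by (auto elim!: nonpos_Ints_cases)
  moreover have "Gamma (\<alpha> + 1) \<noteq> 0" using assms Gamma_real_pos[of "\<alpha> + 1"] by linarith
  ultimately show ?thesis by (subst pochhammer_Gamma) (simp_all add: add_ac)
qed

lemma fact_le_pochhammer:
  fixes \<alpha> :: real
  assumes "\<alpha> \<ge> 0"
  shows "fact m \<le> pochhammer (\<alpha> + 1) m"
proof (induction m)
  case (Suc m)
  have "(1 + real m) * fact m \<le> (\<alpha> + 1 + real m) * pochhammer (\<alpha> + 1) m"
    by (intro mult_mono Suc) (use assms in auto)
  thus ?case by (simp add: pochhammer_Suc mult_ac)
qed simp

lemma summable_bessel_series:
  fixes \<alpha> w :: real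
  assumes "\<alpha> \<ge> 0" "w \<ge> 0"
  shows "summable (\<lambda>m. w ^ m / (fact m * Gamma (real m + \<alpha> + 1)))"
proof (rule summable_comparison_test')
  show "summable (\<lambda>m. w ^ m / fact m / Gamma (\<alpha> + 1))"
    using summable_exp[of w] by (intro summable_divide) (simp add: field_simps)
  fix m :: nat
  have G: "Gamma (\<alpha> + 1) > 0" using assms by (simp add: Gamma_real_pos)
  have p: "1 \<le> pochhammer (\<alpha> + 1) m"
    using fact_le_pochhammer[OF assms(1), of m] fact_ge_1[of m, where 'a = real] by linarith
  have "w ^ m / (fact m * (pochhammer (\<alpha> + 1) m * Gamma (\<alpha> + 1))) \<le> w ^ m / (fact m * (1 * Gamma (\<alpha> + 1)))"
    using G p assms by (intro divide_left_mono mult_left_mono mult_right_mono mult_pos_pos) auto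
  thus "norm (w ^ m / (fact m * Gamma (real m + \<alpha> + 1))) \<le> w ^ m / fact m / Gamma (\<alpha> + 1)"
    using G p assms by (simp add: Gamma_shift_pochhammer abs_mult)
qed

lemma bessel_series_nonneg:
  "\<alpha> \<ge> 0 \<Longrightarrow> w \<ge> 0 \<Longrightarrow> bessel_series \<alpha> w \<ge> 0"
  unfolding bessel_series_def
  by (intro suminf_nonneg summable_bessel_series) (auto intro!: divide_nonneg_nonneg mult_nonneg_nonneg less_imp_le[OF Gamma_real_pos])

lemma hille_hardy_nonneg:
  "\<alpha> \<ge> 0 \<Longrightarrow> 0 \<le> r \<Longrightarrow> 0 \<le> x \<Longrightarrow> 0 \<le> y \<Longrightarrow> hille_hardy \<alpha> r x y \<ge> 0"
  unfolding hille_hardy_def by (intro mult_nonneg_nonneg bessel_series_nonneg) auto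

lemma borel_measurable_bessel_series [measurable]:
  "bessel_series \<alpha> \<in> borel_measurable borel"
  unfolding bessel_series_def by measurable

text \<open>Each term of the Bessel series gives a Gamma integral, and the resulting series in m is
  the one summed by \<open>exp_pochhammer_sums\<close> at z = x r/(1 - r). All terms are
  nonnegative, so sum and integral may be exchanged without further estimates. The value is
  exp(-x/2) n! times the right side of \<open>laguerre_generating_sum\<close>.\<close>

lemma nn_integral_hille_hardy_monomial:
  fixes \<alpha> r x :: real
  assumes \<alpha>: "\<alpha> \<ge> 0" and r: "0 < r" "r < 1" and x: "0 \<le> x"
  shows "(\<integral>\<^sup>+y. ennreal (indicator {0<..} y * (hille_hardy \<alpha> r x y * (y ^ n * exp (- y / 2) * y powr \<alpha>))) \<partial>lborel) =
         ennreal (exp (- x / 2) * fact n *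
           (\<Sum>j\<le>n. ((real n + \<alpha>) gchoose (n - j)) * r ^ j * (1 - r) ^ (n - j) * x ^ j / fact j))"
    (is "?L = ennreal ?R")
proof -
  define c where "c = 1 / (1 - r)"
  have c: "c > 0" using r by (simp add: c_def)
  \<comment> \<open>The first identity merges the kernel's exponential in y with exp(-y/2). The
    second shows that in x a factor exp(-r c x) is left over besides exp(-x/2); it cancels the
    factor \<open>exp z\<close> from \<open>exp_pochhammer_sums\<close>.\<close>
  have c1: "(1 + r) / (2 * (1 - r)) + 1 / 2 = c" "(1 + r) / (2 * (1 - r)) = 1 / 2 + r * c"
    using r by (simp_all add: c_def field_simps)
  define A where "A = (1 - r) powr (- 1 - \<alpha>) * exp (- ((1 + r) / (2 * (1 - r))) * x)"
  have A: "A \<ge> 0" by (simp add: A_def)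
  have Gp: "Gamma (real m + \<alpha> + 1) > 0" for m using \<alpha> by (intro Gamma_real_pos) auto
  let ?u = "\<lambda>m. A * (x * r * c\<^sup>2) ^ m / (fact m * Gamma (real m + \<alpha> + 1))"
  let ?g = "\<lambda>m y. indicator {0<..} y * (y powr (real (m + n) + \<alpha> + 1 - 1) * exp (- c * y))"
  have u: "?u m \<ge> 0" for m using A x r c less_imp_le[OF Gp] by auto
  have "?L = (\<integral>\<^sup>+y. (\<Sum>m. ennreal (?u m * ?g m y)) \<partial>lborel)"
  proof (intro nn_integral_cong)
    fix y :: real
    show "ennreal (indicator {0<..} y * (hille_hardy \<alpha> r x y * (y ^ n * exp (- y / 2) * y powr \<alpha>))) = (\<Sum>m. ennreal (?u m * ?g m y))"
    proof (cases "y > 0")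
      case True
      have ex: "exp (- ((1 + r) / (2 * (1 - r))) * (x + y)) * exp (- y / 2) = exp (- ((1 + r) / (2 * (1 - r))) * x) * exp (- c * y)"
        unfolding c1(1)[symmetric] by (simp flip: exp_add) (simp add: ring_distribs add_divide_distrib)
      have w: "x * y * r / (1 - r)\<^sup>2 = x * r * c\<^sup>2 * y" by (simp add: c_def power_divide)
      have w0: "x * r * c\<^sup>2 * y \<ge> 0" using x r True by auto
      have "(\<lambda>m. (x * r * c\<^sup>2 * y) ^ m / (fact m * Gamma (real m + \<alpha> + 1))) sums bessel_series \<alpha> (x * r * c\<^sup>2 * y)"
        unfolding bessel_series_def by (intro summable_sums summable_bessel_series \<alpha> w0)
      hence "(\<lambda>m. A * exp (- c * y) * y ^ n * y powr \<alpha> * ((x * r * c\<^sup>2 * y) ^ m / (fact m * Gamma (real m + \<alpha> + 1)))) sums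
          (A * exp (- c * y) * y ^ n * y powr \<alpha> * bessel_series \<alpha> (x * r * c\<^sup>2 * y))"
        by (rule sums_mult)
      also have "(\<lambda>m. A * exp (- c * y) * y ^ n * y powr \<alpha> * ((x * r * c\<^sup>2 * y) ^ m / (fact m * Gamma (real m + \<alpha> + 1)))) =
          (\<lambda>m. ?u m * ?g m y)"
        using True by (auto simp: powr_add powr_realpow power_mult_distrib power_add fun_eq_iff mult_ac)
      also have "A * exp (- c * y) * y ^ n * y powr \<alpha> * bessel_series \<alpha> (x * r * c\<^sup>2 * y) =
          hille_hardy \<alpha> r x y * (y ^ n * exp (- y / 2) * y powr \<alpha>)"
        using ex unfolding hille_hardy_def A_def w by (simp add: mult_ac)
      finally have s: "(\<lambda>m. ?u m * ?g m y) sums (hille_hardy \<alpha> r x y * (y ^ n * exp (- y / 2) * y powr \<alpha>))" .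
      have "(\<Sum>m. ennreal (?u m * ?g m y)) = ennreal (\<Sum>m. ?u m * ?g m y)"
        by (intro suminf_ennreal2 sums_summable[OF s] mult_nonneg_nonneg u) (auto simp: indicator_def)
      thus ?thesis using sums_unique[OF s] True by simp
    qed simp
  qed
  also have "\<dots> = (\<Sum>m. \<integral>\<^sup>+y. ennreal (?u m * ?g m y) \<partial>lborel)"
    by (intro nn_integral_suminf) measurable
  also have "\<dots> = (\<Sum>m. ennreal (?u m * (Gamma (real (m + n) + \<alpha> + 1) / c powr (real (m + n) + \<alpha> + 1))))"
  proof (intro suminf_cong)
    fix m
    have "(\<integral>\<^sup>+y. ennreal (?u m * ?g m y) \<partial>lborel) = (\<integral>\<^sup>+y. ennreal (?u m) * ennreal (?g m y) \<partial>lborel)"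
      by (intro nn_integral_cong ennreal_mult' u)
    also have "\<dots> = ennreal (?u m) * (\<integral>\<^sup>+y. ennreal (?g m y) \<partial>lborel)"
      by (intro nn_integral_cmult) measurable
    also have "(\<integral>\<^sup>+y. ennreal (?g m y) \<partial>lborel) = ennreal (Gamma (real (m + n) + \<alpha> + 1) / c powr (real (m + n) + \<alpha> + 1))"
      by (intro nn_integral_powr_exp c) (use \<alpha> in auto)
    finally show "(\<integral>\<^sup>+y. ennreal (?u m * ?g m y) \<partial>lborel) = ennreal (?u m * (Gamma (real (m + n) + \<alpha> + 1) / c powr (real (m + n) + \<alpha> + 1)))"
      using u[of m] by (simp only: ennreal_mult')
  qed
  also have "\<dots> = ennreal ?R"
  proof -
    let ?z = "x * r * c"
    let ?E = "exp (- ((1 + r) / (2 * (1 - r))) * x)"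
    let ?S = "\<Sum>j\<le>n. ((real n + \<alpha>) gchoose (n - j)) * ?z ^ j / fact j"
    have t: "?u m * (Gamma (real (m + n) + \<alpha> + 1) / c powr (real (m + n) + \<alpha> + 1)) =
        ?E / c ^ n * (?z ^ m / fact m * pochhammer (real m + \<alpha> + 1) n)" for m
    proof -
      have "Gamma (real (m + n) + \<alpha> + 1) = pochhammer (real m + \<alpha> + 1) n * Gamma (real m + \<alpha> + 1)"
        using Gamma_shift_pochhammer[of "real m + \<alpha>" n] \<alpha> by (simp add: add_ac)
      moreover have "(1 - r) powr (- 1 - \<alpha>) = c powr (\<alpha> + 1)"
        using r by (simp add: c_def powr_divide powr_minus field_simps flip: powr_minus_divide)
      moreover have "c powr (real (m + n) + \<alpha> + 1) = c ^ m * c ^ n * c powr (\<alpha> + 1)"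
        using c by (simp add: powr_add powr_realpow)
      ultimately show ?thesis
        using c Gp[of m] by (simp add: A_def power_mult_distrib power2_eq_square) (simp add: mult_ac)
    qed
    have "(\<lambda>m. ?E / c ^ n * (?z ^ m / fact m * pochhammer (real m + \<alpha> + 1) n)) sums
        (?E / c ^ n * (exp ?z * fact n * ?S))"
      by (intro sums_mult exp_pochhammer_sums)
    moreover have "?E / c ^ n * (exp ?z * fact n * ?S) = ?R"
    proof -
      have "?E * exp ?z = exp (- x / 2)"
        unfolding c1(2) by (simp flip: exp_add) (simp add: algebra_simps)
      moreover have "?S / c ^ n = (\<Sum>j\<le>n. ((real n + \<alpha>) gchoose (n - j)) * r ^ j * (1 - r) ^ (n - j) * x ^ j / fact j)"
        unfolding sum_divide_distrib
      proof (intro sum.cong refl)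
        fix j assume j: "j \<in> {..n}"
        have "c ^ j / c ^ n = (1 - r) ^ (n - j)"
          using r j by (simp add: c_def power_divide power_diff)
        moreover have "((real n + \<alpha>) gchoose (n - j)) * ?z ^ j / fact j / c ^ n =
            ((real n + \<alpha>) gchoose (n - j)) * r ^ j * (c ^ j / c ^ n) * x ^ j / fact j"
          by (simp add: power_mult_distrib mult_ac)
        ultimately show "((real n + \<alpha>) gchoose (n - j)) * ?z ^ j / fact j / c ^ n =
            ((real n + \<alpha>) gchoose (n - j)) * r ^ j * (1 - r) ^ (n - j) * x ^ j / fact j"
          by simp
      qed
      moreover have "?E / c ^ n * (exp ?z * fact n * ?S) = (?E * exp ?z) * fact n * (?S / c ^ n)"
        by (simp only: mult_ac times_divide_eq_left times_divide_eq_right)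
      ultimately show ?thesis by simp
    qed
    ultimately have s: "(\<lambda>m. ?u m * (Gamma (real (m + n) + \<alpha> + 1) / c powr (real (m + n) + \<alpha> + 1))) sums ?R"
      unfolding t by simp
    have "(\<Sum>m. ennreal (?u m * (Gamma (real (m + n) + \<alpha> + 1) / c powr (real (m + n) + \<alpha> + 1)))) =
        ennreal (\<Sum>m. ?u m * (Gamma (real (m + n) + \<alpha> + 1) / c powr (real (m + n) + \<alpha> + 1)))"
      using \<alpha> by (intro suminf_ennreal2 sums_summable[OF s] mult_nonneg_nonneg u divide_nonneg_nonneg less_imp_le[OF Gamma_real_pos]) auto
    thus ?thesis using sums_unique[OF s] by simp
  qed
  finally show ?thesis .
qed

text \<open>Integrated term by term, the Laguerre polynomial turns into Gamma values; with the
  common factor pulled out, the sum is the finite difference of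
  \<open>alternating_pochhammer_sum\<close>. The vanishing for k > n is the reason why only finitely
  many coefficients of an element of the space are nonzero.\<close>

lemma integral_monomial_laguerre:
  fixes \<alpha> :: real
  assumes \<alpha>: "\<alpha> \<ge> 0"
  shows "has_bochner_integral lborel (\<lambda>y. indicator {0<..} y * (y ^ n * laguerre \<alpha> k y * exp (- y) * y powr \<alpha>))
           (Gamma (real k + \<alpha> + 1) / fact k *
             (if k \<le> n then (-1) ^ k * fact n * ((real n + \<alpha>) gchoose (n - k)) else 0))"
proof -
  let ?c = "\<lambda>i. (-1) ^ i * ((real k + \<alpha>) gchoose (k - i)) / fact i"
  have "has_bochner_integral lborel
      (\<lambda>y. \<Sum>i\<le>k. ?c i * (indicator {0<..} y * (y powr (real (i + n) + \<alpha> + 1 - 1) * exp (- 1 * y))))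
      (\<Sum>i\<le>k. ?c i * (Gamma (real (i + n) + \<alpha> + 1) / 1 powr (real (i + n) + \<alpha> + 1)))"
    by (intro has_bochner_integral_sum has_bochner_integral_mult_right has_bochner_integral_powr_exp)
       (use \<alpha> in auto)
  moreover have "(\<Sum>i\<le>k. ?c i * (indicator {0<..} y * (y powr (real (i + n) + \<alpha> + 1 - 1) * exp (- 1 * y)))) =
      indicator {0<..} y * (y ^ n * laguerre \<alpha> k y * exp (- y) * y powr \<alpha>)" for y :: real
  proof (cases "y > 0")
    case True
    thus ?thesis
      by (simp add: laguerre_def powr_add powr_realpow sum_distrib_left sum_distrib_right power_add)
         (simp add: mult_ac)
  qed simp
  moreover have "(\<Sum>i\<le>k. ?c i * (Gamma (real (i + n) + \<alpha> + 1) / 1 powr (real (i + n) + \<alpha> + 1))) =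
      Gamma (real k + \<alpha> + 1) / fact k * (\<Sum>i\<le>k. (-1) ^ i * real (k choose i) * pochhammer (real i + \<alpha> + 1) n)"
    unfolding sum_distrib_left
  proof (intro sum.cong refl)
    fix i assume "i \<in> {..k}"
    hence i: "i \<le> k" by simp
    have 1: "Gamma (real (i + n) + \<alpha> + 1) = pochhammer (real i + \<alpha> + 1) n * Gamma (real i + \<alpha> + 1)"
      using Gamma_shift_pochhammer[of "real i + \<alpha>" n] \<alpha> by (simp add: add_ac)
    have 2: "Gamma (real k + \<alpha> + 1) = pochhammer (real i + \<alpha> + 1) (k - i) * Gamma (real i + \<alpha> + 1)"
      using Gamma_shift_pochhammer[of "real i + \<alpha>" "k - i"] \<alpha> i by (simp add: add_ac of_nat_diff)
    have 3: "(real k + \<alpha>) gchoose (k - i) = pochhammer (real i + \<alpha> + 1) (k - i) / fact (k - i)"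
      using i by (simp add: gbinomial_pochhammer' of_nat_diff algebra_simps)
    show "?c i * (Gamma (real (i + n) + \<alpha> + 1) / 1 powr (real (i + n) + \<alpha> + 1)) =
      Gamma (real k + \<alpha> + 1) / fact k * ((-1) ^ i * real (k choose i) * pochhammer (real i + \<alpha> + 1) n)"
      using i unfolding 1 2 3 by (simp add: binomial_fact mult_ac)
  qed
  ultimately show ?thesis by (simp only: alternating_pochhammer_sum)
qed

section \<open>The kernel of the fractional integral\<close>


(* The kernel of I_sigma: the average of the Hille-Hardy kernel over r = exp (-t). *)
definition frac_kernel :: "real \<Rightarrow> real \<Rightarrow> real \<Rightarrow> real \<Rightarrow> ennreal" where
  "frac_kernel \<alpha> \<sigma> x y =
     (\<integral>\<^sup>+t. ennreal (indicator {0<..} t * (t powr (\<sigma> - 1) * exp (- t) / Gamma \<sigma>)) *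
        ennreal (hille_hardy \<alpha> (exp (- t)) x y) \<partial>lborel)"

lemma measurable_hille_hardy [measurable]:
  assumes [measurable]: "r \<in> borel_measurable M" "x \<in> borel_measurable M" "y \<in> borel_measurable M"
  shows "(\<lambda>z. hille_hardy \<alpha> (r z) (x z) (y z)) \<in> borel_measurable M"
  unfolding hille_hardy_def by measurable

text \<open>Coefficient and basis function are treated as one product because their two square-root
  normalisations multiply to k!/\<Gamma>(k+\<alpha>+1), the reciprocal of the factor in the moment
  integral. No Gamma values or roots remain.\<close>

lemma laguerre_coeff_times_fun_polynomial:
  fixes P :: "complex poly"
  assumes \<alpha>: "\<alpha> \<ge> 0" and f: "\<And>y. 0 \<le> y \<Longrightarrow> f y = poly P (of_real y) * of_real (exp (- y / 2))"
  shows "laguerre_coeff \<alpha> f k * of_real (laguerre_fun \<alpha> k x) =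
    (\<Sum>n\<le>degree P. coeff P n * of_real (exp (- x / 2) *
       (if k \<le> n then (-1) ^ k * fact n * ((real n + \<alpha>) gchoose (n - k)) else 0) * laguerre \<alpha> k x))"
proof -
  let ?c = "\<lambda>n. if k \<le> n then (-1) ^ k * fact n * ((real n + \<alpha>) gchoose (n - k)) else 0"
  define N where "N = sqrt (fact k / Gamma (real k + \<alpha> + 1))"
  have G: "Gamma (real k + \<alpha> + 1) > 0" using \<alpha> by (intro Gamma_real_pos) auto
  have N: "N * N * (Gamma (real k + \<alpha> + 1) / fact k) = 1"
    using G by (simp add: N_def flip: real_sqrt_mult power2_eq_square)
  have "has_bochner_integral lborel
     (\<lambda>y. \<Sum>n\<le>degree P. (coeff P n * of_real N) * complex_of_real (indicator {0<..} y * (y ^ n * laguerre \<alpha> k y * exp (- y) * y powr \<alpha>)))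
     (\<Sum>n\<le>degree P. (coeff P n * of_real N) * complex_of_real (Gamma (real k + \<alpha> + 1) / fact k * ?c n))"
    by (intro has_bochner_integral_sum has_bochner_integral_mult_right has_bochner_integral_of_real integral_monomial_laguerre \<alpha>)
  moreover have "(\<lambda>y. \<Sum>n\<le>degree P. (coeff P n * of_real N) * complex_of_real (indicator {0<..} y * (y ^ n * laguerre \<alpha> k y * exp (- y) * y powr \<alpha>))) =
      (\<lambda>y. indicat_real {0<..} y *\<^sub>R (f y * complex_of_real (laguerre_fun \<alpha> k y * y powr \<alpha>)))"
  proof
    fix y :: real
    show "(\<Sum>n\<le>degree P. (coeff P n * of_real N) * complex_of_real (indicator {0<..} y * (y ^ n * laguerre \<alpha> k y * exp (- y) * y powr \<alpha>))) =
      indicat_real {0<..} y *\<^sub>R (f y * complex_of_real (laguerre_fun \<alpha> k y * y powr \<alpha>))"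
    proof (cases "y > 0")
      case True
      have e: "complex_of_real (exp (- y)) = of_real (exp (- y / 2)) * of_real (exp (- y / 2))"
        by (simp flip: exp_add of_real_mult)
      show ?thesis using True
        by (simp only: f less_imp_le poly_altdef laguerre_fun_def of_real_mult e N_def[symmetric])
           (simp add: sum_distrib_left sum_distrib_right mult_ac)
    qed simp
  qed
  ultimately have "has_bochner_integral lborel (\<lambda>y. indicat_real {0<..} y *\<^sub>R (f y * complex_of_real (laguerre_fun \<alpha> k y * y powr \<alpha>)))
     (\<Sum>n\<le>degree P. (coeff P n * of_real N) * complex_of_real (Gamma (real k + \<alpha> + 1) / fact k * ?c n))"
    by simp
  hence c: "laguerre_coeff \<alpha> f k = (\<Sum>n\<le>degree P. (coeff P n * of_real N) * complex_of_real (Gamma (real k + \<alpha> + 1) / fact k * ?c n))"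
    unfolding laguerre_coeff_def set_lebesgue_integral_def by (rule has_bochner_integral_integral_eq)
  have "coeff P n * of_real N * complex_of_real (Gamma (real k + \<alpha> + 1) / fact k * ?c n) * of_real (laguerre_fun \<alpha> k x) =
     coeff P n * of_real (exp (- x / 2) * ?c n * laguerre \<alpha> k x)" for n
  proof -
    have "coeff P n * of_real N * complex_of_real (Gamma (real k + \<alpha> + 1) / fact k * ?c n) * of_real (laguerre_fun \<alpha> k x) =
      coeff P n * of_real (N * (Gamma (real k + \<alpha> + 1) / fact k * ?c n) * (N * exp (- x / 2) * laguerre \<alpha> k x))"
      by (simp add: laguerre_fun_def N_def)
    also have "N * (Gamma (real k + \<alpha> + 1) / fact k * ?c n) * (N * exp (- x / 2) * laguerre \<alpha> k x) =
      (N * N * (Gamma (real k + \<alpha> + 1) / fact k)) * (exp (- x / 2) * ?c n * laguerre \<alpha> k x)"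
      by (simp only: mult_ac)
    finally show ?thesis by (simp only: N mult_1)
  qed
  thus ?thesis unfolding c sum_distrib_right by (intro sum.cong refl)
qed

text \<open>For each r the Poisson sum at x is both a finite sum over k and the integral of f
  against the Hille-Hardy kernel, since the two agree on monomials. The triangle inequality is
  applied to that integral and again to the average over t; the exchange of the two integrals then
  concerns a nonnegative integrand only.\<close>

lemma norm_laguerre_frac_int_le:
  assumes \<alpha>: "\<alpha> \<ge> 0" and \<sigma>: "\<sigma> > 0" and f: "f \<in> laguerre_space" and x: "x > 0"
  shows "ennreal (norm (laguerre_frac_int \<alpha> \<sigma> f x)) \<le>
    (\<integral>\<^sup>+y. frac_kernel \<alpha> \<sigma> x y * ennreal (indicator {0<..} y * (norm (f y) * y powr \<alpha>)) \<partial>lborel)"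
proof -
  obtain P :: "complex poly" where P: "\<And>y. 0 \<le> y \<Longrightarrow> f y = poly P (of_real y) * of_real (exp (- y / 2))"
    using f unfolding laguerre_space_def by auto
  define d where "d = degree P"
  \<comment> \<open>\<open>f\<close> is arbitrary at negative arguments and need not be measurable
    there; \<open>g\<close> agrees with it on the half-line and is continuous everywhere.\<close>
  define g where "g = (\<lambda>y::real. poly P (of_real y) * complex_of_real (exp (- y / 2)))"
  have [measurable]: "g \<in> borel_measurable borel"
    unfolding g_def by (intro borel_measurable_continuous_onI continuous_intros) auto
  let ?c = "\<lambda>n k. if k \<le> n then (-1) ^ k * fact n * ((real n + \<alpha>) gchoose (n - k)) else 0"
  define C where "C = (\<lambda>k. \<Sum>n\<le>d. coeff P n * of_real (exp (- x / 2) * ?c n k * laguerre \<alpha> k x))"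
  define S where "S = (\<lambda>r::real. \<Sum>k\<le>d. of_real (r ^ k) * C k)"
  have G: "Gamma \<sigma> > 0" using \<sigma> by (rule Gamma_real_pos)
  have C: "laguerre_coeff \<alpha> f k * of_real (laguerre_fun \<alpha> k x) = C k" for k
    unfolding C_def d_def by (rule laguerre_coeff_times_fun_polynomial[OF \<alpha> P])
  have "laguerre_frac_int \<alpha> \<sigma> f x = (\<Sum>k. of_real ((real k + 1) powr (- \<sigma>)) * C k)"
    unfolding laguerre_frac_int_def C[symmetric] by (simp only: mult.assoc)
  also have "\<dots> = (\<Sum>k\<le>d. of_real ((real k + 1) powr (- \<sigma>)) * C k)"
    by (intro suminf_finite) (auto simp: C_def intro!: sum.neutral)
  finally have I: "laguerre_frac_int \<alpha> \<sigma> f x = (\<Sum>k\<le>d. of_real ((real k + 1) powr (- \<sigma>)) * C k)" .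
  let ?w = "\<lambda>t::real. indicator {0<..} t * (t powr (\<sigma> - 1) * exp (- t) / Gamma \<sigma>)"
  have w0: "?w t \<ge> 0" for t using G by (auto simp: indicator_def)
  have "has_bochner_integral lborel
     (\<lambda>t. \<Sum>k\<le>d. (C k / of_real (Gamma \<sigma>)) * complex_of_real (indicator {0<..} t * (t powr (\<sigma> - 1) * exp (- (real k + 1) * t))))
     (\<Sum>k\<le>d. (C k / of_real (Gamma \<sigma>)) * complex_of_real (Gamma \<sigma> / (real k + 1) powr \<sigma>))"
    by (intro has_bochner_integral_sum has_bochner_integral_mult_right has_bochner_integral_of_real has_bochner_integral_powr_exp \<sigma>) auto
  also have "(\<Sum>k\<le>d. (C k / of_real (Gamma \<sigma>)) * complex_of_real (Gamma \<sigma> / (real k + 1) powr \<sigma>)) = laguerre_frac_int \<alpha> \<sigma> f x"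
    unfolding I using G by (intro sum.cong refl) (simp add: powr_minus field_simps)
  also have "(\<lambda>t. \<Sum>k\<le>d. (C k / of_real (Gamma \<sigma>)) * complex_of_real (indicator {0<..} t * (t powr (\<sigma> - 1) * exp (- (real k + 1) * t)))) =
      (\<lambda>t. of_real (?w t) * S (exp (- t)))"
  proof
    fix t :: real
    have "exp (- (real k + 1) * t) = exp (- t) ^ k * exp (- t)" for k
      by (simp add: algebra_simps flip: exp_of_nat_mult exp_add)
    thus "(\<Sum>k\<le>d. (C k / of_real (Gamma \<sigma>)) * complex_of_real (indicator {0<..} t * (t powr (\<sigma> - 1) * exp (- (real k + 1) * t)))) =
      of_real (?w t) * S (exp (- t))"
      by (simp only: S_def sum_distrib_left) (simp add: mult_ac)
  qed
  finally have hI: "has_bochner_integral lborel (\<lambda>t. of_real (?w t) * S (exp (- t))) (laguerre_frac_int \<alpha> \<sigma> f x)" .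
  \<comment> \<open>\<open>S r\<close> is the sum of r^k a_k l_k(x). \<open>?H n\<close> below is
    the contribution of the n-th monomial, obtained from the kernel and from the Laguerre expansion
    alike.\<close>
  have S: "ennreal (norm (S r)) \<le> (\<integral>\<^sup>+y. ennreal (hille_hardy \<alpha> r x y) * ennreal (indicator {0<..} y * (norm (g y) * y powr \<alpha>)) \<partial>lborel)"
    if r: "0 < r" "r < 1" for r
  proof -
    let ?h = "\<lambda>n y. indicator {0<..} y * (hille_hardy \<alpha> r x y * (y ^ n * exp (- y / 2) * y powr \<alpha>))"
    let ?H = "\<lambda>n. exp (- x / 2) * fact n * (\<Sum>k\<le>n. (- r) ^ k * ((real n + \<alpha>) gchoose (n - k)) * laguerre \<alpha> k x)"
    have h0: "?h n y \<ge> 0" for n y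
      using \<alpha> r x hille_hardy_nonneg[of \<alpha> r x y] by (auto simp: indicator_def)
    have "has_bochner_integral lborel (?h n) (?H n)" for n
    proof (rule has_bochner_integral_nn_integral)
      \<comment> \<open>The alternating form hides the sign; in the rewritten form every summand is
        visibly nonnegative.\<close>
      have "?H n = exp (- x / 2) * fact n *
           (\<Sum>j\<le>n. ((real n + \<alpha>) gchoose (n - j)) * r ^ j * (1 - r) ^ (n - j) * x ^ j / fact j)"
        by (simp only: laguerre_generating_sum)
      also have "\<dots> \<ge> 0"
        using \<alpha> r x by (intro mult_nonneg_nonneg sum_nonneg divide_nonneg_nonneg)
          (auto simp: gbinomial_pochhammer' intro!: pochhammer_nonneg divide_nonneg_nonneg)
      finally show "?H n \<ge> 0" .
      show "(\<integral>\<^sup>+y. ennreal (?h n y) \<partial>lborel) = ennreal (?H n)"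
        unfolding laguerre_generating_sum using \<alpha> r x by (intro nn_integral_hille_hardy_monomial) auto
    qed (use h0 in auto)
    hence "has_bochner_integral lborel (\<lambda>y. \<Sum>n\<le>d. coeff P n * complex_of_real (?h n y)) (\<Sum>n\<le>d. coeff P n * complex_of_real (?H n))"
      by (intro has_bochner_integral_sum has_bochner_integral_mult_right has_bochner_integral_of_real)
    moreover have "(\<Sum>n\<le>d. coeff P n * complex_of_real (?H n)) = S r"
    proof -
      have "?H n = (\<Sum>k\<le>d. r ^ k * (exp (- x / 2) * ?c n k * laguerre \<alpha> k x))" if "n \<le> d" for n
      proof -
        have "(- r) ^ k = r ^ k * (-1) ^ k" for k by (simp flip: power_mult_distrib)
        hence "?H n = (\<Sum>k\<le>n. r ^ k * (exp (- x / 2) * ?c n k * laguerre \<alpha> k x))"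
          unfolding sum_distrib_left by (intro sum.cong refl) (simp add: mult_ac)
        also have "\<dots> = (\<Sum>k\<le>d. r ^ k * (exp (- x / 2) * ?c n k * laguerre \<alpha> k x))"
          by (rule sum.mono_neutral_left) (use that in auto)
        finally show ?thesis .
      qed
      hence "(\<Sum>n\<le>d. coeff P n * complex_of_real (?H n)) =
         (\<Sum>n\<le>d. \<Sum>k\<le>d. of_real (r ^ k) * (coeff P n * complex_of_real (exp (- x / 2) * ?c n k * laguerre \<alpha> k x)))"
        by (intro sum.cong refl) (simp add: sum_distrib_left mult_ac del: of_real_power)
      also have "\<dots> = S r"
        unfolding S_def C_def sum_distrib_left by (rule sum.swap)
      finally show ?thesis .
    qed
    moreover have "(\<Sum>n\<le>d. coeff P n * complex_of_real (?h n y)) = of_real (indicator {0<..} y * (hille_hardy \<alpha> r x y * y powr \<alpha>)) * g y" for y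
      by (simp add: g_def poly_altdef sum_distrib_left sum_distrib_right d_def mult_ac)
    ultimately have hb: "has_bochner_integral lborel (\<lambda>y. of_real (indicator {0<..} y * (hille_hardy \<alpha> r x y * y powr \<alpha>)) * g y) (S r)"
      by simp
    have "ennreal (norm (S r)) \<le> (\<integral>\<^sup>+y. ennreal (norm (of_real (indicator {0<..} y * (hille_hardy \<alpha> r x y * y powr \<alpha>)) * g y)) \<partial>lborel)"
      by (rule has_bochner_integral_norm_bound[OF hb])
    also have "\<dots> = (\<integral>\<^sup>+y. ennreal (hille_hardy \<alpha> r x y) * ennreal (indicator {0<..} y * (norm (g y) * y powr \<alpha>)) \<partial>lborel)"
    proof (intro nn_integral_cong)
      fix y :: real
      show "ennreal (norm (of_real (indicator {0<..} y * (hille_hardy \<alpha> r x y * y powr \<alpha>)) * g y)) =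
         ennreal (hille_hardy \<alpha> r x y) * ennreal (indicator {0<..} y * (norm (g y) * y powr \<alpha>))"
      proof (cases "y > 0")
        case True
        hence "hille_hardy \<alpha> r x y \<ge> 0" using \<alpha> r x by (intro hille_hardy_nonneg) auto
        thus ?thesis using True by (simp add: norm_mult abs_mult mult_ac flip: ennreal_mult)
      qed simp
    qed
    finally show ?thesis .
  qed
  have "ennreal (norm (laguerre_frac_int \<alpha> \<sigma> f x)) \<le> (\<integral>\<^sup>+t. ennreal (norm (of_real (?w t) * S (exp (- t)))) \<partial>lborel)"
    by (rule has_bochner_integral_norm_bound[OF hI])
  also have "\<dots> \<le> (\<integral>\<^sup>+t. \<integral>\<^sup>+y. ennreal (?w t) * ennreal (hille_hardy \<alpha> (exp (- t)) x y) * ennreal (indicator {0<..} y * (norm (g y) * y powr \<alpha>)) \<partial>lborel \<partial>lborel)"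
  proof (intro nn_integral_mono)
    fix t :: real
    have "ennreal (norm (of_real (?w t) * S (exp (- t)))) = ennreal (?w t) * ennreal (norm (S (exp (- t))))"
      using w0[of t] by (simp only: norm_mult norm_of_real abs_of_nonneg ennreal_mult norm_ge_zero)
    also have "\<dots> \<le> ennreal (?w t) * (\<integral>\<^sup>+y. ennreal (hille_hardy \<alpha> (exp (- t)) x y) * ennreal (indicator {0<..} y * (norm (g y) * y powr \<alpha>)) \<partial>lborel)"
    proof (cases "t > 0")
      case True
      thus ?thesis by (intro mult_left_mono S) auto
    qed simp
    also have "\<dots> = (\<integral>\<^sup>+y. ennreal (?w t) * ennreal (hille_hardy \<alpha> (exp (- t)) x y) * ennreal (indicator {0<..} y * (norm (g y) * y powr \<alpha>)) \<partial>lborel)"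
      unfolding mult.assoc by (intro nn_integral_cmult[symmetric]) measurable
    finally show "ennreal (norm (of_real (?w t) * S (exp (- t)))) \<le> \<dots>" .
  qed
  also have "\<dots> = (\<integral>\<^sup>+y. \<integral>\<^sup>+t. ennreal (?w t) * ennreal (hille_hardy \<alpha> (exp (- t)) x y) * ennreal (indicator {0<..} y * (norm (g y) * y powr \<alpha>)) \<partial>lborel \<partial>lborel)"
    by (rule lborel_pair.Fubini') measurable
  also have "\<dots> = (\<integral>\<^sup>+y. frac_kernel \<alpha> \<sigma> x y * ennreal (indicator {0<..} y * (norm (g y) * y powr \<alpha>)) \<partial>lborel)"
    unfolding frac_kernel_def by (intro nn_integral_cong nn_integral_multc) measurable
  also have "\<dots> = (\<integral>\<^sup>+y. frac_kernel \<alpha> \<sigma> x y * ennreal (indicator {0<..} y * (norm (f y) * y powr \<alpha>)) \<partial>lborel)"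
    by (intro nn_integral_cong) (auto simp: indicator_def P g_def)
  finally show ?thesis .
qed

section \<open>Kernel estimates\<close>


lemma powr_le_exp_bound:
  fixes \<eta> c :: real
  assumes "\<eta> \<ge> 0" "c > 0"
  obtains C where "C > 0" "\<And>v. v > 0 \<Longrightarrow> v powr \<eta> \<le> C * exp (c * v)"
proof (cases "\<eta> = 0")
  case True
  show ?thesis by (rule that[of 1]) (use True assms in auto)
next
  case False
  hence \<eta>: "\<eta> > 0" using assms by simp
  show ?thesis
  proof (rule that[of "(\<eta> / c) powr \<eta>"])
    fix v :: real assume v: "v > 0"
    have "c * v / \<eta> \<le> exp (c * v / \<eta>)" using exp_ge_add_one_self[of "c * v / \<eta>"] by linarith
    hence "(c * v / \<eta>) powr \<eta> \<le> exp (c * v / \<eta>) powr \<eta>"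
      using v \<eta> assms by (intro powr_mono2) auto
    also have "\<dots> = exp (c * v)" using \<eta> by (simp add: powr_def)
    finally have "(\<eta> / c) powr \<eta> * (c * v / \<eta>) powr \<eta> \<le> (\<eta> / c) powr \<eta> * exp (c * v)"
      by (intro mult_left_mono) auto
    also have "(\<eta> / c) powr \<eta> * (c * v / \<eta>) powr \<eta> = v powr \<eta>"
      using \<eta> assms v by (simp flip: powr_mult)
    finally show "v powr \<eta> \<le> (\<eta> / c) powr \<eta> * exp (c * v)" .
  qed (use \<eta> assms in auto)
qed

(* With a = \<alpha> + 1/2 and s = m + \<alpha> + 1, the ratio of consecutive left-hand sides is 1 - a/s,
   which is at most (1 + 1/s) powr (-a). *)
lemma pochhammer_half_ratio_le:
  fixes \<alpha> :: real
  assumes "\<alpha> \<ge> 0"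
  shows "pochhammer (1 / 2) m / pochhammer (\<alpha> + 1) m \<le> ((\<alpha> + 1) / (real m + \<alpha> + 1)) powr (\<alpha> + 1 / 2)"
proof (induction m)
  case 0
  thus ?case using assms by simp
next
  case (Suc m)
  define a s where "a = \<alpha> + 1 / 2" and "s = real m + \<alpha> + 1"
  have s: "s > 0" and a: "a \<ge> 0" using assms by (auto simp: s_def a_def)
  have "1 - a / s \<le> exp (- (a / s))" using exp_ge_add_one_self[of "- (a / s)"] by simp
  also have "a * ln (1 + 1 / s) \<le> a * (1 / s)"
    using ln_add_one_self_le_self[of "1 / s"] s a by (intro mult_left_mono) auto
  hence "exp (- (a / s)) \<le> exp (- (a * ln (1 + 1 / s)))" by simp
  also have "\<dots> = (1 + 1 / s) powr (- a)" using s add_pos_pos[of 1 "1 / s"] by (simp add: powr_def)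
  also have "\<dots> = inverse (1 + 1 / s) powr a" using s by (simp add: powr_minus inverse_powr)
  also have "inverse (1 + 1 / s) = s / (s + 1)" using s by (simp add: field_simps)
  finally have step: "1 - a / s \<le> (s / (s + 1)) powr a" .
  have "pochhammer (1 / 2) (Suc m) / pochhammer (\<alpha> + 1) (Suc m) =
      (pochhammer (1 / 2) m / pochhammer (\<alpha> + 1) m) * ((1 / 2 + real m) / (\<alpha> + 1 + real m))"
    by (simp add: pochhammer_Suc)
  also have "(1 / 2 + real m) / (\<alpha> + 1 + real m) = 1 - a / s"
    using assms by (simp add: a_def s_def field_simps)
  also have "(pochhammer (1 / 2) m / pochhammer (\<alpha> + 1) m) * (1 - a / s) \<le>
      ((\<alpha> + 1) / s) powr a * (s / (s + 1)) powr a"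
    using Suc.IH step assms
    by (intro mult_mono) (auto simp: a_def s_def field_simps)
  also have "\<dots> = ((\<alpha> + 1) / (s + 1)) powr a"
    using s assms by (simp flip: powr_mult)
  finally show ?case by (simp add: a_def s_def add_ac)
qed

lemma partial_exp_shift_sum_le:
  fixes z :: real
  assumes "z \<ge> 0"
  shows "(\<Sum>m<n. z ^ (2 * m + N) / fact (2 * m + N)) \<le> exp z"
proof -
  have "(\<Sum>m<n. z ^ (2 * m + N) / fact (2 * m + N)) = (\<Sum>i\<in>(\<lambda>m. 2 * m + N) ` {..<n}. z ^ i /\<^sub>R fact i)"
    by (subst sum.reindex) (auto simp: inj_on_def divide_inverse mult_ac)
  also have "\<dots> \<le> (\<Sum>i. z ^ i /\<^sub>R fact i)"
    using assms by (intro sum_le_suminf summable_exp_generic) auto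
  finally show ?thesis by (simp add: exp_def)
qed

lemma fact_add_le: "fact (n + N) \<le> (fact n * real (n + N) ^ N :: real)"
proof (induction N)
  case (Suc N)
  have "fact (n + Suc N) = real (n + Suc N) * fact (n + N)" by simp
  also have "\<dots> \<le> real (n + Suc N) * (fact n * real (n + N) ^ N)"
    by (intro mult_left_mono Suc) auto
  also have "\<dots> \<le> real (n + Suc N) * (fact n * real (n + Suc N) ^ N)"
    by (intro mult_left_mono power_mono) auto
  finally show ?case by (simp add: mult_ac)
qed simp

text \<open>Since (2m)! = 4^m m! (1/2)_m, the m-th term at w = z^2/4 is the term z^(2m)/(2m)! of the
  exponential series times (1/2)_m / (\<alpha>+1)_m, up to a constant. This ratio decays like
  m^(-\<alpha>-1/2), which is where the restriction on \<eta> comes from.\<close>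

lemma bessel_series_bound:
  fixes \<alpha> \<eta> :: real
  assumes \<alpha>: "\<alpha> \<ge> 0" and \<eta>: "0 \<le> \<eta>" "\<eta> \<le> \<alpha> + 1 / 2"
  obtains C where "C > 0" "\<And>z. z > 0 \<Longrightarrow> z powr \<eta> * bessel_series \<alpha> (z\<^sup>2 / 4) \<le> C * exp z"
proof -
  \<comment> \<open>The decay of the ratio turns \<open>z powr \<eta>\<close> into
    \<open>(z / (m + 1)) powr \<eta>\<close>. A fractional power does not fit the exponential
    series, so it is bounded by 1 plus the N-th power; the latter moves (2m)! to (2m+N)! at the cost
    of (N+2)^N, because 2m + N <= (N+2)(m+1).\<close>
  define N where "N = nat \<lceil>\<eta>\<rceil>"
  have N: "\<eta> \<le> real N" using \<eta> unfolding N_def by linarith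
  define G where "G = Gamma (\<alpha> + 1)"
  have G: "G > 0" using \<alpha> by (simp add: G_def Gamma_real_pos)
  define B where "B = (\<alpha> + 1) powr (\<alpha> + 1 / 2) / G"
  have B: "B > 0" using \<alpha> G by (simp add: B_def)
  have summand: "z powr \<eta> * ((z\<^sup>2 / 4) ^ m / (fact m * Gamma (real m + \<alpha> + 1))) \<le>
      B * (z ^ (2 * m) / fact (2 * m) + real (N + 2) ^ N * (z ^ (2 * m + N) / fact (2 * m + N)))"
    if z: "z > 0" for z m
  proof -
    let ?P = "pochhammer (1 / 2) m / pochhammer (\<alpha> + 1) m :: real"
    have pp: "pochhammer (\<alpha> + 1) m > 0" "pochhammer (1 / 2 :: real) m > 0" using \<alpha> by (auto intro: pochhammer_pos)
    have "(z\<^sup>2 / 4) ^ m / (fact m * Gamma (real m + \<alpha> + 1)) = z ^ (2 * m) / fact (2 * m) * (?P / G)"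
      using pp \<alpha> G
      by (simp add: fact_double Gamma_shift_pochhammer G_def power_divide power_mult)
    also have "z powr \<eta> * (z ^ (2 * m) / fact (2 * m) * (?P / G)) \<le> z powr \<eta> * (z ^ (2 * m) / fact (2 * m) * (B * (real m + 1) powr (- \<eta>)))"
    proof -
      have "?P \<le> (\<alpha> + 1) powr (\<alpha> + 1 / 2) / (real m + \<alpha> + 1) powr (\<alpha> + 1 / 2)"
        using pochhammer_half_ratio_le[OF \<alpha>, of m] \<alpha> by (simp add: powr_divide)
      also have "\<dots> \<le> (\<alpha> + 1) powr (\<alpha> + 1 / 2) / (real m + 1) powr \<eta>"
      proof (intro divide_left_mono mult_pos_pos)
        have "(real m + 1) powr \<eta> \<le> (real m + 1) powr (\<alpha> + 1 / 2)" using \<eta> by (intro powr_mono) auto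
        also have "\<dots> \<le> (real m + \<alpha> + 1) powr (\<alpha> + 1 / 2)" using \<alpha> by (intro powr_mono2) auto
        finally show "(real m + 1) powr \<eta> \<le> (real m + \<alpha> + 1) powr (\<alpha> + 1 / 2)" .
      qed (use \<alpha> in auto)
      finally have "?P / G \<le> B * (real m + 1) powr (- \<eta>)"
        using G by (simp add: B_def powr_minus field_simps)
      thus ?thesis using z by (intro mult_left_mono) auto
    qed
    also have "\<dots> = B * (z ^ (2 * m) / fact (2 * m) * (z / (real m + 1)) powr \<eta>)"
      using z by (simp add: powr_divide powr_minus field_simps)
    also have "\<dots> \<le> B * (z ^ (2 * m) / fact (2 * m) * (1 + (z / (real m + 1)) ^ N))"
    proof -
      let ?t = "z / (real m + 1)"
      have t: "?t > 0" using z by simp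
      have "?t powr \<eta> \<le> 1 + ?t ^ N"
      proof (cases "?t \<le> 1")
        case True
        have "?t powr \<eta> \<le> 1" using powr_mono2[of \<eta> ?t 1] t True \<eta> by simp
        thus ?thesis using t by (simp add: add_increasing2)
      next
        case False
        have "?t powr \<eta> \<le> ?t powr real N" using False N by (intro powr_mono) auto
        thus ?thesis using t by (simp add: powr_realpow)
      qed
      thus ?thesis using z B by (intro mult_left_mono) auto
    qed
    also have "\<dots> \<le> B * (z ^ (2 * m) / fact (2 * m) + real (N + 2) ^ N * (z ^ (2 * m + N) / fact (2 * m + N)))"
    proof -
      have "fact (2 * m + N) \<le> (fact (2 * m) * real (2 * m + N) ^ N :: real)" by (rule fact_add_le)
      also have "real (2 * m + N) \<le> real (N + 2) * (real m + 1)" by (simp add: algebra_simps)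
      hence "fact (2 * m) * real (2 * m + N) ^ N \<le> fact (2 * m) * (real (N + 2) * (real m + 1)) ^ N"
        by (intro mult_left_mono power_mono) auto
      finally have F: "fact (2 * m + N) \<le> fact (2 * m) * (real (N + 2) ^ N * (real m + 1) ^ N)"
        by (simp only: power_mult_distrib)
      have "1 / (fact (2 * m) * (real m + 1) ^ N) = real (N + 2) ^ N / (fact (2 * m) * (real (N + 2) ^ N * (real m + 1) ^ N))"
        by simp
      also have "\<dots> \<le> real (N + 2) ^ N / fact (2 * m + N)"
        using F by (intro divide_left_mono) auto
      finally have "z ^ (2 * m + N) * (1 / (fact (2 * m) * (real m + 1) ^ N)) \<le> z ^ (2 * m + N) * (real (N + 2) ^ N / fact (2 * m + N))"
        using z by (intro mult_left_mono) auto
      hence "z ^ (2 * m) / fact (2 * m) * (z / (real m + 1)) ^ N \<le> real (N + 2) ^ N * (z ^ (2 * m + N) / fact (2 * m + N))"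
        by (simp add: power_add power_divide mult_ac)
      thus ?thesis using B by (intro mult_left_mono) (auto simp: distrib_left)
    qed
    finally show ?thesis .
  qed
  show ?thesis
  proof (rule that[of "B * (1 + real (N + 2) ^ N)"])
    show "B * (1 + real (N + 2) ^ N) > 0" using B by (intro mult_pos_pos add_pos_nonneg) auto
    fix z :: real assume z: "z > 0"
    let ?f = "\<lambda>m. z powr \<eta> * ((z\<^sup>2 / 4) ^ m / (fact m * Gamma (real m + \<alpha> + 1)))"
    have sm: "summable (\<lambda>m. (z\<^sup>2 / 4) ^ m / (fact m * Gamma (real m + \<alpha> + 1)))"
      using \<alpha> by (intro summable_bessel_series) auto
    have "z powr \<eta> * bessel_series \<alpha> (z\<^sup>2 / 4) = suminf ?f"
      unfolding bessel_series_def by (rule suminf_mult[OF sm, symmetric])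
    also have "\<dots> \<le> B * (1 + real (N + 2) ^ N) * exp z"
    proof (rule suminf_le_const)
      show "summable ?f" by (rule summable_mult[OF sm])
      fix n
      have "sum ?f {..<n} \<le> (\<Sum>m<n. B * (z ^ (2 * m) / fact (2 * m) + real (N + 2) ^ N * (z ^ (2 * m + N) / fact (2 * m + N))))"
        by (intro sum_mono summand z)
      also have "\<dots> = B * ((\<Sum>m<n. z ^ (2 * m + 0) / fact (2 * m + 0)) + real (N + 2) ^ N * (\<Sum>m<n. z ^ (2 * m + N) / fact (2 * m + N)))"
        by (simp only: sum.distrib sum_distrib_left[symmetric] add_0_right)
      also have "\<dots> \<le> B * (exp z + real (N + 2) ^ N * exp z)"
        using B z by (intro mult_left_mono add_mono partial_exp_shift_sum_le) auto
      finally show "sum ?f {..<n} \<le> B * (1 + real (N + 2) ^ N) * exp z" by (simp add: algebra_simps)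
    qed
    finally show "z powr \<eta> * bessel_series \<alpha> (z\<^sup>2 / 4) \<le> B * (1 + real (N + 2) ^ N) * exp z" .
  qed
qed

(* For small r the argument 2 v sqrt r of the Bessel function is too small to give the decay
   v^(-\<eta>); there it comes from the surplus exp ((1 - sqrt r)^2 v) in the bound. *)
lemma bessel_series_bound_uniform:
  fixes \<alpha> \<eta> :: real
  assumes \<alpha>: "\<alpha> \<ge> 0" and \<eta>: "0 \<le> \<eta>" "\<eta> \<le> \<alpha> + 1 / 2"
  obtains C where "C > 0"
    "\<And>r v. 0 < r \<Longrightarrow> r < 1 \<Longrightarrow> v > 0 \<Longrightarrow> v powr \<eta> * bessel_series \<alpha> (r * v\<^sup>2) \<le> C * exp ((1 + r) * v)"
proof -
  obtain C0 where C0: "C0 > 0" "\<And>z. z > 0 \<Longrightarrow> z powr 0 * bessel_series \<alpha> (z\<^sup>2 / 4) \<le> C0 * exp z"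
    using bessel_series_bound[OF \<alpha>, of 0] \<alpha> by (metis order.refl add_nonneg_nonneg zero_le_divide_1_iff zero_le_numeral)
  obtain C1 where C1: "C1 > 0" "\<And>z. z > 0 \<Longrightarrow> z powr \<eta> * bessel_series \<alpha> (z\<^sup>2 / 4) \<le> C1 * exp z"
    using bessel_series_bound[OF \<alpha> \<eta>] by metis
  obtain C2 where C2: "C2 > 0" "\<And>v. v > 0 \<Longrightarrow> v powr \<eta> \<le> C2 * exp (1 / 4 * v)"
    using powr_le_exp_bound[of \<eta> "1 / 4"] \<eta> by (metis zero_less_divide_1_iff zero_less_numeral)
  show ?thesis
  proof (rule that[of "C1 + C2 * C0"])
    show "C1 + C2 * C0 > 0" using C0 C1 C2 by (intro add_pos_pos mult_pos_pos) auto
    fix r v :: real assume r: "0 < r" "r < 1" and v: "v > 0"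
    define z where "z = 2 * sqrt r * v"
    have z: "z > 0" using r v by (simp add: z_def)
    have z2: "z\<^sup>2 / 4 = r * v\<^sup>2" using r by (simp add: z_def power_mult_distrib)
    have sq: "(1 - sqrt r)\<^sup>2 = 1 + r - 2 * sqrt r" using r by (simp add: power2_diff)
    have zle: "z \<le> (1 + r) * v"
    proof -
      have "2 * sqrt r \<le> 1 + r" using sq zero_le_power2[of "1 - sqrt r"] by linarith
      thus ?thesis unfolding z_def using v by (intro mult_right_mono) auto
    qed
    have b0: "bessel_series \<alpha> (r * v\<^sup>2) \<ge> 0" using \<alpha> r by (intro bessel_series_nonneg) auto
    show "v powr \<eta> * bessel_series \<alpha> (r * v\<^sup>2) \<le> (C1 + C2 * C0) * exp ((1 + r) * v)"
    \<comment> \<open>From 1/4 on, sqrt r >= 1/2 and hence z >= v. Below it, (1 - sqrt r)^2 >= 1/4,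
      which is the rate chosen for \<open>C2\<close>.\<close>
    proof (cases "r \<ge> 1 / 4")
      case True
      have "1 / 2 \<le> sqrt r" using real_sqrt_le_mono[OF True] by (simp add: real_sqrt_divide)
      hence "1 * v \<le> 2 * sqrt r * v" using v by (intro mult_right_mono) auto
      hence "v powr \<eta> \<le> z powr \<eta>" using v \<eta> by (intro powr_mono2) (auto simp: z_def)
      hence "v powr \<eta> * bessel_series \<alpha> (r * v\<^sup>2) \<le> z powr \<eta> * bessel_series \<alpha> (z\<^sup>2 / 4)"
        using b0 unfolding z2 by (intro mult_right_mono)
      also have "\<dots> \<le> C1 * exp z" by (rule C1(2)[OF z])
      also have "\<dots> \<le> (C1 + C2 * C0) * exp ((1 + r) * v)"
        using zle C0 C1 C2 by (intro mult_mono) auto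
      finally show ?thesis .
    next
      case False
      have "sqrt r \<le> 1 / 2" using real_sqrt_le_mono[of r "1 / 4"] False by (simp add: real_sqrt_divide)
      hence "(1 / 2)\<^sup>2 \<le> (1 - sqrt r)\<^sup>2" by (intro power_mono) auto
      hence "1 / 4 + 2 * sqrt r \<le> 1 + r" unfolding sq by (simp add: power2_eq_square)
      hence "(1 / 4 + 2 * sqrt r) * v \<le> (1 + r) * v" using v by (intro mult_right_mono) auto
      hence zle': "1 / 4 * v + z \<le> (1 + r) * v" by (simp add: z_def algebra_simps)
      have "bessel_series \<alpha> (r * v\<^sup>2) \<le> C0 * exp z" using C0(2)[OF z] z unfolding z2 by simp
      hence "v powr \<eta> * bessel_series \<alpha> (r * v\<^sup>2) \<le> (C2 * exp (1 / 4 * v)) * (C0 * exp z)"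
        using C2 v b0 by (intro mult_mono) auto
      also have "\<dots> = (C2 * C0) * exp (1 / 4 * v + z)" by (simp add: exp_add mult_ac)
      also have "\<dots> \<le> (C1 + C2 * C0) * exp ((1 + r) * v)"
        using zle' C0 C1 C2 by (intro mult_mono) auto
      finally show ?thesis .
    qed
  qed
qed

text \<open>With v = sqrt(xy)/(1 - r) the Bessel argument is r v^2. The growth exp((1+r) v), rather
  than the sharper exp(2 sqrt(r) v), has the same factor 1 + r as the exponential in the kernel, so
  the two complete the square (sqrt x - sqrt y)^2 exactly; afterwards 1 + r >= 1 is dropped from the
  exponent.\<close>

lemma hille_hardy_bound:
  fixes \<alpha> \<eta> :: real
  assumes \<alpha>: "\<alpha> \<ge> 0" and \<eta>: "0 \<le> \<eta>" "\<eta> \<le> \<alpha> + 1 / 2"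
  obtains C where "C > 0"
    "\<And>r x y. 0 < r \<Longrightarrow> r < 1 \<Longrightarrow> x > 0 \<Longrightarrow> y > 0 \<Longrightarrow> hille_hardy \<alpha> r x y \<le>
       C * (x * y) powr (- \<eta> / 2) * (1 - r) powr (\<eta> - 1 - \<alpha>) * exp (- ((sqrt x - sqrt y)\<^sup>2 / (2 * (1 - r))))"
proof -
  obtain C where C: "C > 0"
    "\<And>r v. 0 < r \<Longrightarrow> r < 1 \<Longrightarrow> v > 0 \<Longrightarrow> v powr \<eta> * bessel_series \<alpha> (r * v\<^sup>2) \<le> C * exp ((1 + r) * v)"
    using bessel_series_bound_uniform[OF \<alpha> \<eta>] by metis
  show ?thesis
  proof (rule that[OF C(1)])
    fix r x y :: real assume r: "0 < r" "r < 1" and x: "x > 0" and y: "y > 0"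
    define v where "v = sqrt (x * y) / (1 - r)"
    have v: "v > 0" using r x y by (simp add: v_def)
    have w: "x * y * r / (1 - r)\<^sup>2 = r * v\<^sup>2" using x y by (simp add: v_def power_divide)
    have d: "(sqrt x - sqrt y)\<^sup>2 = x + y - 2 * sqrt (x * y)"
      using x y by (simp add: power2_diff real_sqrt_mult)
    have ex: "- ((1 + r) / (2 * (1 - r))) * (x + y) + (1 + r) * v = - ((1 + r) * ((sqrt x - sqrt y)\<^sup>2 / (2 * (1 - r))))"
    proof -
      define c where "c = 1 / (1 - r)"
      have "A / (2 * (1 - r)) = A * c / 2" "A / (1 - r) = A * c" for A by (simp_all add: c_def)
      thus ?thesis unfolding d v_def by (simp only:) (simp add: algebra_simps add_divide_distrib diff_divide_distrib)
    qed
    have ex2: "- ((1 + r) * ((sqrt x - sqrt y)\<^sup>2 / (2 * (1 - r)))) \<le> - ((sqrt x - sqrt y)\<^sup>2 / (2 * (1 - r)))"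
      using r mult_right_mono[of 1 "1 + r" "(sqrt x - sqrt y)\<^sup>2 / (2 * (1 - r))"] by simp
    have vp: "v powr (- \<eta>) = (x * y) powr (- \<eta> / 2) * (1 - r) powr \<eta>"
      using r x y by (simp add: v_def powr_divide powr_minus powr_half_sqrt[symmetric] powr_powr field_simps)
    have "bessel_series \<alpha> (r * v\<^sup>2) = v powr (- \<eta>) * (v powr \<eta> * bessel_series \<alpha> (r * v\<^sup>2))"
      using v by (simp add: powr_minus field_simps)
    also have "\<dots> \<le> v powr (- \<eta>) * (C * exp ((1 + r) * v))"
      by (intro mult_left_mono C r v) auto
    finally have "hille_hardy \<alpha> r x y \<le> (1 - r) powr (- 1 - \<alpha>) * exp (- ((1 + r) / (2 * (1 - r))) * (x + y)) *
        (v powr (- \<eta>) * (C * exp ((1 + r) * v)))"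
      unfolding hille_hardy_def w by (intro mult_left_mono) auto
    also have "\<dots> = C * (x * y) powr (- \<eta> / 2) * ((1 - r) powr \<eta> * (1 - r) powr (- 1 - \<alpha>)) *
        exp (- ((1 + r) / (2 * (1 - r))) * (x + y) + (1 + r) * v)"
      unfolding vp exp_add by (simp only: mult_ac)
    also have "(1 - r) powr \<eta> * (1 - r) powr (- 1 - \<alpha>) = (1 - r) powr (\<eta> - 1 - \<alpha>)"
      by (simp add: algebra_simps flip: powr_add)
    also have "C * (x * y) powr (- \<eta> / 2) * (1 - r) powr (\<eta> - 1 - \<alpha>) *
        exp (- ((1 + r) / (2 * (1 - r))) * (x + y) + (1 + r) * v) \<le>
      C * (x * y) powr (- \<eta> / 2) * (1 - r) powr (\<eta> - 1 - \<alpha>) * exp (- ((sqrt x - sqrt y)\<^sup>2 / (2 * (1 - r))))"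
      using ex2 C unfolding ex by (intro mult_left_mono) auto
    finally show "hille_hardy \<alpha> r x y \<le>
       C * (x * y) powr (- \<eta> / 2) * (1 - r) powr (\<eta> - 1 - \<alpha>) * exp (- ((sqrt x - sqrt y)\<^sup>2 / (2 * (1 - r))))" .
  qed
qed


section \<open>Integration over t and the homogeneous majorant\<close>

lemma nn_integral_powr_to_inf:
  fixes m c :: real
  assumes "m > 1" "c > 0"
  shows "(\<integral>\<^sup>+t. ennreal (indicator {c..} t * t powr (- m)) \<partial>lborel) = ennreal (c powr (1 - m) / (m - 1))"
proof -
  have "(\<integral>\<^sup>+t. ennreal (indicator {c..} t * t powr (- m)) \<partial>lborel) = ennreal (- (c powr (- m + 1)) / (- m + 1))"
    by (intro nn_integral_has_integral_lebesgue has_integral_powr_to_inf) (use assms in auto)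
  also have "- (c powr (- m + 1)) / (- m + 1) = - (c powr (1 - m)) / - (m - 1)" by simp
  also have "\<dots> = c powr (1 - m) / (m - 1)" by (rule minus_divide_divide)
  finally show ?thesis .
qed

lemma nn_integral_powr_from_0:
  fixes a c :: real
  assumes "a > -1" "c \<ge> 0"
  shows "(\<integral>\<^sup>+t. ennreal (indicator {0..c} t * t powr a) \<partial>lborel) = ennreal (c powr (a + 1) / (a + 1))"
  by (intro nn_integral_has_integral_lebesgue has_integral_powr_from_0) (use assms in auto)

text \<open>Replaces 1 - r = 1 - exp(-t) by t. The two are comparable near 0; for large t the power
  of t decays while that of 1 - r does not, and the factor exp(-t) from the Gamma integral pays for
  the difference.\<close>

lemma exp_neg_one_minus_exp_powr_le:
  fixes A :: real
  assumes "A \<ge> 0"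
  obtains C where "C > 0" "\<And>t. t > 0 \<Longrightarrow> exp (- t) * (1 - exp (- t)) powr (- A) \<le> C * t powr (- A)"
proof -
  obtain C where C: "C > 0" "\<And>v. v > 0 \<Longrightarrow> v powr A \<le> C * exp (1 * v)"
    using powr_le_exp_bound[OF assms, of 1] by auto
  show ?thesis
  proof (rule that[of "C * exp 1"])
    fix t :: real assume t: "t > 0"
    have "exp (- t) \<le> 1 / (1 + t)"
      using t exp_ge_add_one_self[of t] by (simp add: exp_minus field_simps)
    hence "t / (1 + t) \<le> 1 - exp (- t)" using t by (simp add: field_simps)
    hence "(1 - exp (- t)) powr (- A) \<le> (t / (1 + t)) powr (- A)"
      using t assms by (intro powr_mono2') auto
    also have "\<dots> = (1 + t) powr A * t powr (- A)"
      using t by (simp add: powr_divide powr_minus field_simps)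
    also have "\<dots> \<le> (C * exp (1 + t)) * t powr (- A)"
      using C(2)[of "1 + t"] t by (intro mult_right_mono) auto
    finally have "exp (- t) * (1 - exp (- t)) powr (- A) \<le> exp (- t) * ((C * exp (1 + t)) * t powr (- A))"
      by (intro mult_left_mono) auto
    also have "\<dots> = C * exp 1 * t powr (- A)" by (simp add: exp_add exp_minus)
    finally show "exp (- t) * (1 - exp (- t)) powr (- A) \<le> C * exp 1 * t powr (- A)" .
  qed (use C in auto)
qed

text \<open>With D = (sqrt x - sqrt y)^2 the integrand is at most a multiple of t^(-m) exp(-D/(2t)),
  so by scaling the integral is of order D^(1-m), and 1 - m is the exponent claimed. The exponential
  gives convergence at 0; convergence at infinity needs m > 1, which is the condition \<eta> <
  \<alpha> + 1 - \<sigma>.\<close>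

lemma frac_kernel_bound:
  fixes \<alpha> \<sigma> \<eta> :: real
  assumes \<alpha>: "\<alpha> \<ge> 0" and \<sigma>: "\<sigma> > 0" and \<eta>: "0 \<le> \<eta>" "\<eta> \<le> \<alpha> + 1 / 2" "\<eta> < \<alpha> + 1 - \<sigma>"
  obtains C where "C > 0" "\<And>x y. x > 0 \<Longrightarrow> y > 0 \<Longrightarrow> x \<noteq> y \<Longrightarrow>
    frac_kernel \<alpha> \<sigma> x y \<le> ennreal (C * (x * y) powr (- \<eta> / 2) * ((sqrt x - sqrt y)\<^sup>2) powr (- (\<alpha> + 1 - \<sigma> - \<eta>)))"
proof -
  define A m where "A = 1 + \<alpha> - \<eta>" and "m = A - \<sigma> + 1"
  have m: "m > 1" and A: "A \<ge> 0" using \<eta> \<sigma> by (auto simp: m_def A_def)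
  obtain C1 where C1: "C1 > 0"
    "\<And>r x y. 0 < r \<Longrightarrow> r < 1 \<Longrightarrow> x > 0 \<Longrightarrow> y > 0 \<Longrightarrow> hille_hardy \<alpha> r x y \<le>
       C1 * (x * y) powr (- \<eta> / 2) * (1 - r) powr (\<eta> - 1 - \<alpha>) * exp (- ((sqrt x - sqrt y)\<^sup>2 / (2 * (1 - r))))"
    using hille_hardy_bound[OF \<alpha> \<eta>(1,2)] by metis
  obtain C2 where C2: "C2 > 0" "\<And>t. t > 0 \<Longrightarrow> exp (- t) * (1 - exp (- t)) powr (- A) \<le> C2 * t powr (- A)"
    using exp_neg_one_minus_exp_powr_le[OF A] by metis
  obtain C3 where C3: "C3 > 0" "\<And>v. v > 0 \<Longrightarrow> v powr m \<le> C3 * exp (1 / 2 * v)"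
    using powr_le_exp_bound[of m "1 / 2"] m by auto
  have G: "Gamma \<sigma> > 0" using \<sigma> by (rule Gamma_real_pos)
  define C where "C = C1 * C2 / Gamma \<sigma> * (C3 + 1 / (m - 1))"
  show ?thesis
  proof (rule that[of C])
    show "C > 0" using C1 C2 C3 m G by (auto simp: C_def intro!: mult_pos_pos add_pos_pos divide_pos_pos)
    fix x y :: real assume x: "x > 0" and y: "y > 0" and xy: "x \<noteq> y"
    define D where "D = (sqrt x - sqrt y)\<^sup>2"
    have D: "D > 0" using x y xy by (simp add: D_def)
    define B where "B = C1 * C2 / Gamma \<sigma> * (x * y) powr (- \<eta> / 2)"
    have B: "B \<ge> 0" using C1 C2 G by (simp add: B_def)
    \<comment> \<open>The split at t = D replaces the substitution t = D s. Below D, (D/t)^m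
      exp(-D/(2t)) is bounded by \<open>C3\<close>, so the integrand is at most a constant times
      D^(-m) on an interval of length D; above D the exponential is bounded by 1. Both parts have
      order D^(1-m).\<close>
    have pt: "ennreal (indicator {0<..} t * (t powr (\<sigma> - 1) * exp (- t) / Gamma \<sigma>)) * ennreal (hille_hardy \<alpha> (exp (- t)) x y) \<le>
        ennreal (B * C3 * D powr (- m)) * indicator {0..D} t + ennreal B * ennreal (indicator {D..} t * t powr (- m))" for t
    proof (cases "t > 0")
      case t: True
      let ?r = "exp (- t)"
      have r: "0 < ?r" "?r < 1" using t by auto
      have e: "exp (- (D / (2 * (1 - ?r)))) \<le> exp (- (D / (2 * t)))"
      proof -
        have "1 - ?r \<le> t" using exp_ge_add_one_self[of "- t"] by simp
        hence "D / (2 * t) \<le> D / (2 * (1 - ?r))" using r t D by (intro divide_left_mono) auto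
        thus ?thesis by simp
      qed
      have "t powr (\<sigma> - 1) * exp (- t) / Gamma \<sigma> * hille_hardy \<alpha> ?r x y \<le>
         t powr (\<sigma> - 1) * exp (- t) / Gamma \<sigma> * (C1 * (x * y) powr (- \<eta> / 2) * (1 - ?r) powr (- A) * exp (- (D / (2 * (1 - ?r)))))"
        using C1(2)[OF r x y] G by (intro mult_left_mono) (auto simp: A_def D_def diff_diff_eq)
      also have "\<dots> = t powr (\<sigma> - 1) / Gamma \<sigma> * (C1 * (x * y) powr (- \<eta> / 2)) * ((exp (- t) * (1 - ?r) powr (- A)) * exp (- (D / (2 * (1 - ?r)))))"
        by simp
      also have "\<dots> \<le> t powr (\<sigma> - 1) / Gamma \<sigma> * (C1 * (x * y) powr (- \<eta> / 2)) * ((C2 * t powr (- A)) * exp (- (D / (2 * t))))"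
        using C1(1) C2(1) G by (intro mult_left_mono mult_mono[OF C2(2)[OF t] e]) auto
      also have "\<dots> = B * (t powr (- m) * exp (- (D / (2 * t))))"
      proof -
        have "t powr (- m) = t powr (\<sigma> - 1) * t powr (- A)" by (simp add: m_def algebra_simps flip: powr_add)
        thus ?thesis by (simp add: B_def)
      qed
      finally have main: "t powr (\<sigma> - 1) * exp (- t) / Gamma \<sigma> * hille_hardy \<alpha> ?r x y \<le> B * (t powr (- m) * exp (- (D / (2 * t))))" .
      have "t powr (- m) * exp (- (D / (2 * t))) \<le> C3 * D powr (- m) * indicator {0..D} t + indicator {D..} t * t powr (- m)"
      proof (cases "t \<le> D")
        case True
        have "(D / t) powr m * exp (- (D / (2 * t))) \<le> C3 * exp (1 / 2 * (D / t)) * exp (- (D / (2 * t)))"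
          using C3(2)[of "D / t"] D t by (intro mult_right_mono) auto
        also have "\<dots> = C3" by (simp flip: exp_add)
        finally have "D powr (- m) * ((D / t) powr m * exp (- (D / (2 * t)))) \<le> D powr (- m) * C3"
          by (intro mult_left_mono) auto
        also have "D powr (- m) * ((D / t) powr m * exp (- (D / (2 * t)))) = t powr (- m) * exp (- (D / (2 * t)))"
          using D t by (simp add: powr_divide powr_minus field_simps)
        finally show ?thesis using True t by (simp add: indicator_def mult.commute add_increasing2)
      next
        case False
        have "t powr (- m) * exp (- (D / (2 * t))) \<le> t powr (- m) * 1"
          using D t by (intro mult_left_mono) auto
        thus ?thesis using False by simp
      qed
      hence "B * (t powr (- m) * exp (- (D / (2 * t)))) \<le> B * (C3 * D powr (- m) * indicator {0..D} t + indicator {D..} t * t powr (- m))"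
        by (rule mult_left_mono[OF _ B])
      with main have "t powr (\<sigma> - 1) * exp (- t) / Gamma \<sigma> * hille_hardy \<alpha> ?r x y \<le>
           B * C3 * D powr (- m) * indicator {0..D} t + B * (indicator {D..} t * t powr (- m))"
        by (simp add: distrib_left mult.assoc)
      hence "ennreal (t powr (\<sigma> - 1) * exp (- t) / Gamma \<sigma> * hille_hardy \<alpha> ?r x y) \<le>
           ennreal (B * C3 * D powr (- m) * indicator {0..D} t + B * (indicator {D..} t * t powr (- m)))"
        by (rule ennreal_leI)
      also have "\<dots> = ennreal (B * C3 * D powr (- m)) * indicator {0..D} t + ennreal B * ennreal (indicator {D..} t * t powr (- m))"
        using B C3 by (auto simp: indicator_def ennreal_mult)
      finally show ?thesis using t G \<alpha> x y hille_hardy_nonneg[of \<alpha> ?r x y] by (simp flip: ennreal_mult)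
    qed simp
    have "frac_kernel \<alpha> \<sigma> x y \<le> (\<integral>\<^sup>+t. ennreal (B * C3 * D powr (- m)) * indicator {0..D} t + ennreal B * ennreal (indicator {D..} t * t powr (- m)) \<partial>lborel)"
      unfolding frac_kernel_def by (intro nn_integral_mono pt)
    also have "\<dots> = ennreal (B * C3 * D powr (- m)) * ennreal D + ennreal B * ennreal (D powr (1 - m) / (m - 1))"
      using D m by (simp add: nn_integral_add nn_integral_cmult nn_integral_powr_to_inf)
    also have "\<dots> = ennreal (B * (C3 + 1 / (m - 1)) * D powr (1 - m))"
    proof -
      have "B * C3 * D powr (- m) * D + B * (D powr (1 - m) / (m - 1)) = B * (C3 + 1 / (m - 1)) * D powr (1 - m)"
      proof -
        have "D powr (- m) * D = D powr (1 - m)" using D by (simp add: powr_diff powr_minus divide_inverse)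
        hence "B * C3 * D powr (- m) * D = B * C3 * D powr (1 - m)" by (simp only: mult.assoc)
        thus ?thesis by (simp add: distrib_left distrib_right)
      qed
      moreover have nonneg: "B * C3 * D powr (- m) \<ge> 0" "D powr (1 - m) / (m - 1) \<ge> 0" using B C3 m by auto
      hence "ennreal (B * C3 * D powr (- m)) * ennreal D + ennreal B * ennreal (D powr (1 - m) / (m - 1)) =
          ennreal (B * C3 * D powr (- m) * D + B * (D powr (1 - m) / (m - 1)))"
        using B D by (simp only: ennreal_plus ennreal_mult mult_nonneg_nonneg less_imp_le)
      ultimately show ?thesis by simp
    qed
    also have "B * (C3 + 1 / (m - 1)) * D powr (1 - m) = C * (x * y) powr (- \<eta> / 2) * D powr (- (\<alpha> + 1 - \<sigma> - \<eta>))"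
    proof -
      have "1 - m = - (\<alpha> + 1 - \<sigma> - \<eta>)" by (simp add: m_def A_def)
      thus ?thesis unfolding B_def C_def by (simp only: mult_ac)
    qed
    finally show "frac_kernel \<alpha> \<sigma> x y \<le> ennreal (C * (x * y) powr (- \<eta> / 2) * ((sqrt x - sqrt y)\<^sup>2) powr (- (\<alpha> + 1 - \<sigma> - \<eta>)))"
      by (simp add: D_def)
  qed
qed

(* Majorant of K(u,1), up to a constant. At u = 1 its value is 0, as 0 powr (-\<theta>) = 0, so it
   bounds the kernel only off the diagonal. *)
definition kernel_profile :: "real \<Rightarrow> real \<Rightarrow> real \<Rightarrow> real" where
  "kernel_profile \<delta> \<theta> u = (if u \<le> 1 / 4 then 1 else if u < 4 then \<bar>1 - u\<bar> powr (- \<theta>) else u powr (- \<delta>))"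

lemma kernel_profile_nonneg: "kernel_profile \<delta> \<theta> u \<ge> 0"
  by (simp add: kernel_profile_def)

lemma borel_measurable_kernel_profile [measurable]:
  "kernel_profile \<delta> \<theta> \<in> borel_measurable borel"
  unfolding kernel_profile_def by measurable

(* Away from the diagonal take \<eta> = 0 in the previous bound; near it, \<eta> = \<delta> - \<theta>/2. *)
lemma frac_kernel_le_profile:
  fixes \<alpha> \<sigma> \<delta> \<theta> :: real
  assumes \<alpha>: "\<alpha> \<ge> 0" and \<sigma>: "\<sigma> > 0" and \<delta>: "\<delta> = \<alpha> + 1 - \<sigma>" "\<delta> > 0"
    and \<theta>: "0 < \<theta>" "1 - 2 * \<sigma> \<le> \<theta>" "\<theta> \<le> 2 * \<delta>"
  obtains C where "C > 0" "\<And>x y. x > 0 \<Longrightarrow> y > 0 \<Longrightarrow> x \<noteq> y \<Longrightarrow>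
    frac_kernel \<alpha> \<sigma> x y \<le> ennreal (C * y powr (- \<delta>) * kernel_profile \<delta> \<theta> (x / y))"
proof -
  \<comment> \<open>The three conditions on \<theta> are those on \<eta>: \<theta> > 0 is \<eta> <
    \<delta>, \<theta> >= 1 - 2 \<sigma> is \<eta> <= \<alpha> + 1/2, and \<theta> <= 2 \<delta> is
    \<eta> >= 0.\<close>
  define \<eta> where "\<eta> = \<delta> - \<theta> / 2"
  have "0 \<le> \<eta>" "\<eta> \<le> \<alpha> + 1 / 2" "\<eta> < \<alpha> + 1 - \<sigma>"
    using \<theta> \<delta> by (auto simp: \<eta>_def field_simps)
  then obtain C1 where C1: "C1 > 0" "\<And>x y. x > 0 \<Longrightarrow> y > 0 \<Longrightarrow> x \<noteq> y \<Longrightarrow>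
    frac_kernel \<alpha> \<sigma> x y \<le> ennreal (C1 * (x * y) powr (- \<eta> / 2) * ((sqrt x - sqrt y)\<^sup>2) powr (- (\<alpha> + 1 - \<sigma> - \<eta>)))"
    using frac_kernel_bound[OF \<alpha> \<sigma>, of \<eta>] by metis
  have "(0::real) \<le> 0" "0 \<le> \<alpha> + 1 / 2" "0 < \<alpha> + 1 - \<sigma>" using \<alpha> \<delta> by auto
  then obtain C0 where C0: "C0 > 0" "\<And>x y. x > 0 \<Longrightarrow> y > 0 \<Longrightarrow> x \<noteq> y \<Longrightarrow>
    frac_kernel \<alpha> \<sigma> x y \<le> ennreal (C0 * (x * y) powr (- 0 / 2) * ((sqrt x - sqrt y)\<^sup>2) powr (- (\<alpha> + 1 - \<sigma> - 0)))"
    using frac_kernel_bound[OF \<alpha> \<sigma>, of 0] by metis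
  \<comment> \<open>4^\<delta> comes from (sqrt u - 1)^2 >= 1/4 for u <= 1/4 and >= u/4 for u >= 4.
    In the middle range, u > 1/4 gives 4^(\<eta>/2), and 1 - u = (1 - sqrt u)(1 + sqrt u) with 1 +
    sqrt u <= 3 gives 9^(\<theta>/2).\<close>
  define C where "C = C0 * 4 powr \<delta> + C1 * (4 powr (\<eta> / 2) * 9 powr (\<theta> / 2))"
  have Cle: "C0 * 4 powr \<delta> \<le> C" "C1 * (4 powr (\<eta> / 2) * 9 powr (\<theta> / 2)) \<le> C"
    using C0 C1 by (auto simp: C_def)
  have C: "C > 0" using C0 C1 by (auto simp: C_def intro!: add_pos_pos)
  show ?thesis
  proof (rule that[OF C])
    fix x y :: real assume x: "x > 0" and y: "y > 0" and xy: "x \<noteq> y"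
    define u where "u = x / y"
    have u: "u > 0" "u \<noteq> 1" and xu: "x = u * y" using x y xy by (auto simp: u_def)
    have sq: "(sqrt x - sqrt y)\<^sup>2 = y * (sqrt u - 1)\<^sup>2"
      using y u by (simp add: xu real_sqrt_mult power2_eq_square algebra_simps)
    have su: "(sqrt u - 1)\<^sup>2 > 0" using u by simp
    have far: "frac_kernel \<alpha> \<sigma> x y \<le> ennreal (C0 * (y powr (- \<delta>) * ((sqrt u - 1)\<^sup>2) powr (- \<delta>)))"
      using C0(2)[OF x y xy] x y unfolding sq by (simp add: powr_mult \<delta>)
    consider (small) "u \<le> 1 / 4" | (large) "u \<ge> 4" | (mid) "1 / 4 < u" "u < 4" by linarith
    thus "frac_kernel \<alpha> \<sigma> x y \<le> ennreal (C * y powr (- \<delta>) * kernel_profile \<delta> \<theta> (x / y))"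
    proof cases
      case small
      have "sqrt u \<le> 1 / 2" using real_sqrt_le_mono[OF small] by (simp add: real_sqrt_divide)
      hence "(1 / 2)\<^sup>2 \<le> (1 - sqrt u)\<^sup>2" by (intro power_mono) auto
      hence "1 / 4 \<le> (sqrt u - 1)\<^sup>2" by (subst power2_commute) (simp add: power2_eq_square)
      hence "((sqrt u - 1)\<^sup>2) powr (- \<delta>) \<le> (1 / 4) powr (- \<delta>)" using \<delta> by (intro powr_mono2') auto
      also have "\<dots> = 4 powr \<delta>" by (simp add: powr_divide powr_minus)
      finally have "C0 * (y powr (- \<delta>) * ((sqrt u - 1)\<^sup>2) powr (- \<delta>)) \<le> C0 * (y powr (- \<delta>) * 4 powr \<delta>)"
        using C0 by (intro mult_left_mono) auto
      also have "\<dots> \<le> C * y powr (- \<delta>) * kernel_profile \<delta> \<theta> u"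
        using mult_right_mono[OF Cle(1), of "y powr (- \<delta>)"] small by (simp add: kernel_profile_def mult_ac)
      finally show ?thesis using far by (auto simp: u_def intro: order.trans ennreal_leI)
    next
      case large
      have "2 \<le> sqrt u" using real_sqrt_le_mono[OF large] by simp
      hence "(sqrt u / 2)\<^sup>2 \<le> (sqrt u - 1)\<^sup>2" using u by (intro power_mono) auto
      hence "u / 4 \<le> (sqrt u - 1)\<^sup>2" using u by (simp add: power_divide)
      hence "((sqrt u - 1)\<^sup>2) powr (- \<delta>) \<le> (u / 4) powr (- \<delta>)" using \<delta> u by (intro powr_mono2') auto
      also have "\<dots> = 4 powr \<delta> * u powr (- \<delta>)" using u by (simp add: powr_divide powr_minus field_simps)
      finally have "C0 * (y powr (- \<delta>) * ((sqrt u - 1)\<^sup>2) powr (- \<delta>)) \<le> C0 * (y powr (- \<delta>) * (4 powr \<delta> * u powr (- \<delta>)))"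
        using C0 by (intro mult_left_mono) auto
      also have "\<dots> \<le> C * y powr (- \<delta>) * kernel_profile \<delta> \<theta> u"
        using mult_right_mono[OF Cle(1), of "y powr (- \<delta>) * u powr (- \<delta>)"] large by (simp add: kernel_profile_def mult_ac)
      finally show ?thesis using far by (auto simp: u_def intro: order.trans ennreal_leI)
    next
      case mid
      have xy': "(x * y) powr (- \<eta> / 2) = u powr (- \<eta> / 2) * y powr (- \<eta>)"
        using u y by (simp add: xu powr_mult flip: powr_add)
      have d: "\<alpha> + 1 - \<sigma> - \<eta> = \<theta> / 2" using \<delta> by (simp add: \<eta>_def)
      have "frac_kernel \<alpha> \<sigma> x y \<le> ennreal (C1 * (x * y) powr (- \<eta> / 2) * ((sqrt x - sqrt y)\<^sup>2) powr (- (\<alpha> + 1 - \<sigma> - \<eta>)))"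
        by (rule C1(2)[OF x y xy])
      also have "C1 * (x * y) powr (- \<eta> / 2) * ((sqrt x - sqrt y)\<^sup>2) powr (- (\<alpha> + 1 - \<sigma> - \<eta>)) =
          C1 * (u powr (- \<eta> / 2) * ((sqrt u - 1)\<^sup>2) powr (- (\<theta> / 2))) * y powr (- \<delta>)"
      proof -
        have "y powr (- \<delta>) = y powr (- \<eta>) * y powr (- (\<theta> / 2))" by (simp add: \<eta>_def flip: powr_add)
        thus ?thesis using y su unfolding xy' sq d by (simp add: powr_mult)
      qed
      also have "\<dots> \<le> C1 * (4 powr (\<eta> / 2) * (9 powr (\<theta> / 2) * \<bar>1 - u\<bar> powr (- \<theta>))) * y powr (- \<delta>)"
      proof (intro mult_left_mono mult_right_mono mult_mono)
        have "u powr (- \<eta> / 2) \<le> (1 / 4) powr (- \<eta> / 2)" using mid \<open>0 \<le> \<eta>\<close> by (intro powr_mono2') auto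
        also have "\<dots> = 4 powr (\<eta> / 2)" by (simp add: powr_divide powr_minus)
        finally show "u powr (- \<eta> / 2) \<le> 4 powr (\<eta> / 2)" .
        have su3: "sqrt u + 1 \<le> 3" using real_sqrt_le_mono[of u 4] mid by simp
        have "(1 - u)\<^sup>2 = (sqrt u - 1)\<^sup>2 * (sqrt u + 1)\<^sup>2"
          using u by (simp add: power2_commute flip: power_mult_distrib) (simp add: algebra_simps power2_commute)
        also have "\<dots> \<le> (sqrt u - 1)\<^sup>2 * 3\<^sup>2"
          using su3 u by (intro mult_left_mono power_mono) auto
        finally have "(1 - u)\<^sup>2 / 9 \<le> (sqrt u - 1)\<^sup>2" by simp
        hence "((sqrt u - 1)\<^sup>2) powr (- (\<theta> / 2)) \<le> ((1 - u)\<^sup>2 / 9) powr (- (\<theta> / 2))"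
          using \<theta> u by (intro powr_mono2') auto
        also have "\<dots> = 9 powr (\<theta> / 2) * ((1 - u)\<^sup>2) powr (- (\<theta> / 2))"
          by (simp add: powr_divide powr_minus field_simps)
        also have "(1 - u)\<^sup>2 = \<bar>1 - u\<bar> powr 2" using u by (subst powr_numeral) auto
        also have "(\<bar>1 - u\<bar> powr 2) powr (- (\<theta> / 2)) = \<bar>1 - u\<bar> powr (- \<theta>)"
          by (subst powr_powr) simp
        finally show "((sqrt u - 1)\<^sup>2) powr (- (\<theta> / 2)) \<le> 9 powr (\<theta> / 2) * \<bar>1 - u\<bar> powr (- \<theta>)" .
      qed (use C1 in auto)
      also have "\<dots> = C1 * (4 powr (\<eta> / 2) * 9 powr (\<theta> / 2)) * (y powr (- \<delta>) * \<bar>1 - u\<bar> powr (- \<theta>))" by simp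
      also have "\<dots> \<le> C * (y powr (- \<delta>) * \<bar>1 - u\<bar> powr (- \<theta>))" by (intro mult_right_mono Cle) auto
      also have "\<dots> = C * y powr (- \<delta>) * kernel_profile \<delta> \<theta> (x / y)" using mid by (simp add: kernel_profile_def flip: u_def)
      finally show ?thesis by (auto simp: ennreal_leI)
    qed
  qed
qed

section \<open>Young's inequality for kernels\<close>


text \<open>Concavity of the logarithm, as its tangent bound at the weighted mean \<open>M\<close>.
  Only the first weight is assumed positive: it will be 1/q, whereas 1/p - 1/q vanishes for p = q.
  It makes \<open>M\<close> positive.\<close>

lemma weighted_AM_GM3:
  fixes u v w \<kappa> \<mu> \<nu> :: real
  assumes "0 \<le> u" "0 \<le> v" "0 \<le> w" "0 < \<kappa>" "0 \<le> \<mu>" "0 \<le> \<nu>" "\<kappa> + \<mu> + \<nu> = 1"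
  shows "u powr \<kappa> * v powr \<mu> * w powr \<nu> \<le> \<kappa> * u + \<mu> * v + \<nu> * w"
proof (cases "u = 0 \<or> v = 0 \<or> w = 0")
  case True
  \<comment> \<open>As \<open>0 powr 0 = 0\<close>, a vanishing factor makes the left side 0 even
    when its exponent is 0.\<close>
  thus ?thesis using assms by auto
next
  case False
  hence pos: "u > 0" "v > 0" "w > 0" using assms by auto
  define M where "M = \<kappa> * u + \<mu> * v + \<nu> * w"
  have M: "M > 0" unfolding M_def using assms pos by (intro add_pos_nonneg mult_pos_pos) auto
  have l: "t * ln z \<le> t * (ln M + (z / M - 1))" if "t \<ge> 0" "z > 0" for t z
    using that M ln_le_minus_one[of "z / M"] by (intro mult_left_mono) (auto simp: ln_div)
  have "\<kappa> * ln u + \<mu> * ln v + \<nu> * ln w \<le>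
      \<kappa> * (ln M + (u / M - 1)) + \<mu> * (ln M + (v / M - 1)) + \<nu> * (ln M + (w / M - 1))"
    using assms pos by (intro add_mono l) auto
  also have "\<dots> = (\<kappa> + \<mu> + \<nu>) * ln M + (\<kappa> * u + \<mu> * v + \<nu> * w) / M - (\<kappa> + \<mu> + \<nu>)"
    by (simp add: algebra_simps add_divide_distrib)
  also have "\<dots> = ln M" using M assms by (simp flip: M_def)
  finally have "exp (\<kappa> * ln u + \<mu> * ln v + \<nu> * ln w) \<le> M" using M by (metis exp_le_cancel_iff exp_ln)
  thus ?thesis using pos by (simp add: powr_def exp_add M_def)
qed

text \<open>A Schur-type form: bounds on row and column integrals of k^r stand in for translation
  invariance. One writes kh = (h^p k^r)^(1/q) (h^p)^(1/p-1/q) (k^r)^(1/r-1/q), with exponents of sum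
  1. Normalised AM-GM replaces the three-factor Hoelder inequality in y and leaves only
  \<open>F x\<close>, whose integral over x is at most H A by the column bound.\<close>

lemma Young_kernel_inequality:
  fixes k :: "'a \<Rightarrow> 'b \<Rightarrow> real" and h :: "'b \<Rightarrow> real" and T :: "'a \<Rightarrow> real" and p q r A H :: real
  assumes "sigma_finite_measure M" "sigma_finite_measure N"
    and k [measurable]: "(\<lambda>(x, y). k x y) \<in> borel_measurable (M \<Otimes>\<^sub>M N)"
    and h [measurable]: "h \<in> borel_measurable N"
    and k0: "\<And>x y. 0 \<le> k x y" and h0: "\<And>y. 0 \<le> h y" and T0: "\<And>x. 0 \<le> T x"
    and pqr: "1 \<le> p" "p \<le> q" "1 \<le> r" "1 + 1 / q = 1 / p + 1 / r"
    and A: "0 < A" and H: "0 < H"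
    and kx: "\<And>x. x \<in> space M \<Longrightarrow> (\<integral>\<^sup>+y. ennreal (k x y powr r) \<partial>N) \<le> ennreal A"
    and ky: "\<And>y. y \<in> space N \<Longrightarrow> (\<integral>\<^sup>+x. ennreal (k x y powr r) \<partial>M) \<le> ennreal A"
    and hp: "(\<integral>\<^sup>+y. ennreal (h y powr p) \<partial>N) \<le> ennreal H"
    and T: "\<And>x. x \<in> space M \<Longrightarrow> ennreal (T x) \<le> (\<integral>\<^sup>+y. ennreal (k x y * h y) \<partial>N)"
  shows "(\<integral>\<^sup>+x. ennreal (T x powr q) \<partial>M) \<le> ennreal (H powr (q / p) * A powr (q / r))"
proof -
  interpret M: sigma_finite_measure M by fact
  interpret N: sigma_finite_measure N by fact
  interpret pair_sigma_finite M N ..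
  define D where "D = H powr (1 / p) * A powr (1 / r)"
  have D: "D > 0" using A H by (simp add: D_def)
  define F where "F = (\<lambda>x. \<integral>\<^sup>+y. ennreal (h y powr p * k x y powr r) \<partial>N)"
  have q: "q > 0" using pqr by linarith
  have mu: "0 \<le> 1 / p - 1 / q" using pqr q by (simp add: frac_le)
  have "1 / p \<le> 1" using pqr by simp
  hence nu: "0 \<le> 1 / r - 1 / q" using pqr by linarith
  (* Weighted AM-GM with a free scale \<Phi>, to be chosen proportional to F x. *)
  have main: "T x \<le> D * \<Phi> powr (1 / q) * (1 / q * (G / (H * A * \<Phi>)) + (1 - 1 / q))"
    if x: "x \<in> space M" and \<Phi>: "\<Phi> > 0" and G: "F x = ennreal G" "G \<ge> 0" for x \<Phi> G
  proof -
    have pt: "k x y * h y \<le> D * \<Phi> powr (1 / q) *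
        (1 / q * (h y powr p * k x y powr r / (H * A * \<Phi>)) + (1 / p - 1 / q) * (h y powr p / H) + (1 / r - 1 / q) * (k x y powr r / A))" for y
    proof -
      have "k x y * h y = D * \<Phi> powr (1 / q) *
        ((h y powr p * k x y powr r / (H * A * \<Phi>)) powr (1 / q) * (h y powr p / H) powr (1 / p - 1 / q) * (k x y powr r / A) powr (1 / r - 1 / q))"
      proof (cases "k x y = 0 \<or> h y = 0")
        case False
        hence pos: "k x y > 0" "h y > 0" using k0[of x y] h0[of y] by linarith+
        \<comment> \<open>Taking logarithms turns the factorisation into a linear identity in the
          exponents.\<close>
        have "ln (k x y * h y) = ln (D * \<Phi> powr (1 / q) *
          ((h y powr p * k x y powr r / (H * A * \<Phi>)) powr (1 / q) * (h y powr p / H) powr (1 / p - 1 / q) * (k x y powr r / A) powr (1 / r - 1 / q)))"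
          using pos A H \<Phi> pqr q by (simp add: D_def ln_mult ln_div ln_powr field_simps)
        thus ?thesis using pos A H \<Phi> D by (subst (asm) ln_inj_iff) (auto intro!: mult_pos_pos)
      qed (use pqr in auto)
      also have "\<dots> \<le> D * \<Phi> powr (1 / q) *
        (1 / q * (h y powr p * k x y powr r / (H * A * \<Phi>)) + (1 / p - 1 / q) * (h y powr p / H) + (1 / r - 1 / q) * (k x y powr r / A))"
        using D A H \<Phi> mu nu q pqr
        by (intro mult_left_mono weighted_AM_GM3) (auto intro!: mult_nonneg_nonneg divide_nonneg_nonneg)
      finally show ?thesis .
    qed
    let ?c1 = "D * \<Phi> powr (1 / q) * (1 / q / (H * A * \<Phi>))"
    let ?c2 = "D * \<Phi> powr (1 / q) * ((1 / p - 1 / q) / H)"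
    let ?c3 = "D * \<Phi> powr (1 / q) * ((1 / r - 1 / q) / A)"
    have c: "?c1 \<ge> 0" "?c2 \<ge> 0" "?c3 \<ge> 0"
      using D A H \<Phi> q mu nu by (auto intro!: mult_nonneg_nonneg divide_nonneg_nonneg)
    have [measurable]: "k x \<in> borel_measurable N"
      using measurable_compose[OF measurable_Pair1'[OF x] k] by simp
    have "ennreal (T x) \<le> (\<integral>\<^sup>+y. ennreal (k x y * h y) \<partial>N)" by (rule T[OF x])
    also have "\<dots> \<le> (\<integral>\<^sup>+y. ennreal ?c1 * ennreal (h y powr p * k x y powr r) + ennreal ?c2 * ennreal (h y powr p) + ennreal ?c3 * ennreal (k x y powr r) \<partial>N)"
    proof (intro nn_integral_mono)
      fix y
      have "ennreal (k x y * h y) \<le> ennreal (?c1 * (h y powr p * k x y powr r) + ?c2 * (h y powr p) + ?c3 * (k x y powr r))"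
        using pt[of y] by (intro ennreal_leI) (simp add: algebra_simps add_divide_distrib diff_divide_distrib)
      also have "\<dots> = ennreal ?c1 * ennreal (h y powr p * k x y powr r) + ennreal ?c2 * ennreal (h y powr p) + ennreal ?c3 * ennreal (k x y powr r)"
        using c by (simp only: ennreal_plus ennreal_mult mult_nonneg_nonneg add_nonneg_nonneg powr_ge_zero)
      finally show "ennreal (k x y * h y) \<le> \<dots>" .
    qed
    also have "\<dots> = ennreal ?c1 * F x + ennreal ?c2 * (\<integral>\<^sup>+y. ennreal (h y powr p) \<partial>N) + ennreal ?c3 * (\<integral>\<^sup>+y. ennreal (k x y powr r) \<partial>N)"
      unfolding F_def by (simp add: nn_integral_add nn_integral_cmult)
    also have "\<dots> \<le> ennreal ?c1 * ennreal G + ennreal ?c2 * ennreal H + ennreal ?c3 * ennreal A"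
      using kx[OF x] hp G by (intro add_mono mult_left_mono) auto
    also have "\<dots> = ennreal (?c1 * G + ?c2 * H + ?c3 * A)"
      using c G H A by (simp only: ennreal_plus ennreal_mult mult_nonneg_nonneg add_nonneg_nonneg less_imp_le)
    finally have "T x \<le> ?c1 * G + ?c2 * H + ?c3 * A"
      by (subst (asm) ennreal_le_iff)
         (intro add_nonneg_nonneg mult_nonneg_nonneg[OF c(1) G(2)] mult_nonneg_nonneg[OF c(2)] mult_nonneg_nonneg[OF c(3)] less_imp_le[OF H] less_imp_le[OF A])
    also have "\<dots> = D * \<Phi> powr (1 / q) * (1 / q * (G / (H * A * \<Phi>)) + ((1 / p - 1 / q) + (1 / r - 1 / q)))"
    proof -
      have "?c1 * G = D * \<Phi> powr (1 / q) * (1 / q * (G / (H * A * \<Phi>)))"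
        "?c2 * H = D * \<Phi> powr (1 / q) * (1 / p - 1 / q)" "?c3 * A = D * \<Phi> powr (1 / q) * (1 / r - 1 / q)"
        using H A by simp_all
      thus ?thesis by (simp only: distrib_left add.assoc)
    qed
    also have "(1 / p - 1 / q) + (1 / r - 1 / q) = 1 - 1 / q" using pqr by simp
    finally show ?thesis .
  qed
  have bound: "ennreal (T x powr q) \<le> ennreal (D powr q / (H * A)) * F x" if x: "x \<in> space M" for x
  proof (cases "F x")
    case (real G)
    \<comment> \<open>For G > 0 the scale \<Phi> = G/(HA) makes the bracket in \<open>main\<close>
      equal to 1. For G = 0 it is not admissible, and \<Phi> = (e/D)^q with arbitrary e > 0 forces
      \<open>T x\<close> to be 0.\<close>
    have "T x \<le> D * (G / (H * A)) powr (1 / q)"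
    proof (cases "G = 0")
      case False
      hence "G > 0" using real by simp
      thus ?thesis using main[OF x _ real(2,1), of "G / (H * A)"] H A q
        by (auto simp: field_simps)
    next
      case True
      have "T x \<le> e" if e: "e > 0" for e
      proof -
        have "T x \<le> D * ((e / D) powr q) powr (1 / q) * (1 - 1 / q)"
          using main[OF x _ real(2,1), of "(e / D) powr q"] e D True by simp
        also have "\<dots> \<le> D * ((e / D) powr q) powr (1 / q) * 1"
          using D e q by (intro mult_left_mono) auto
        also have "\<dots> = e" using D e q by (simp add: powr_powr)
        finally show ?thesis .
      qed
      hence "T x \<le> 0" by (meson dense_ge)
      thus ?thesis using True by simp
    qed
    hence "T x powr q \<le> (D * (G / (H * A)) powr (1 / q)) powr q"
      using T0 q by (intro powr_mono2) auto
    also have "\<dots> = D powr q / (H * A) * G"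
      using real H A D q by (cases "G = 0") (auto simp: powr_mult powr_powr)
    finally show ?thesis using real H A by (simp flip: ennreal_mult)
  next
    case top
    thus ?thesis using D H A by (simp add: ennreal_mult_top)
  qed
  have "(\<integral>\<^sup>+x. ennreal (T x powr q) \<partial>M) \<le> (\<integral>\<^sup>+x. ennreal (D powr q / (H * A)) * F x \<partial>M)"
    by (intro nn_integral_mono bound)
  also have "\<dots> = ennreal (D powr q / (H * A)) * (\<integral>\<^sup>+x. F x \<partial>M)"
    unfolding F_def by (intro nn_integral_cmult) measurable
  also have "(\<integral>\<^sup>+x. F x \<partial>M) = (\<integral>\<^sup>+y. \<integral>\<^sup>+x. ennreal (h y powr p * k x y powr r) \<partial>M \<partial>N)"
    unfolding F_def by (intro Fubini'[symmetric]) measurable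
  also have "\<dots> = (\<integral>\<^sup>+y. ennreal (h y powr p) * (\<integral>\<^sup>+x. ennreal (k x y powr r) \<partial>M) \<partial>N)"
  proof (intro nn_integral_cong)
    fix y assume y: "y \<in> space N"
    have [measurable]: "(\<lambda>x. k x y) \<in> borel_measurable M"
      using measurable_compose[OF measurable_Pair2'[OF y] k] by simp
    show "(\<integral>\<^sup>+x. ennreal (h y powr p * k x y powr r) \<partial>M) = ennreal (h y powr p) * (\<integral>\<^sup>+x. ennreal (k x y powr r) \<partial>M)"
      by (simp add: ennreal_mult nn_integral_cmult)
  qed
  also have "\<dots> \<le> (\<integral>\<^sup>+y. ennreal (h y powr p) * ennreal A \<partial>N)"
    by (intro nn_integral_mono mult_left_mono ky) auto
  also have "\<dots> = (\<integral>\<^sup>+y. ennreal (h y powr p) \<partial>N) * ennreal A"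
    by (intro nn_integral_multc) measurable
  also have "\<dots> \<le> ennreal H * ennreal A"
    by (intro mult_right_mono hp) auto
  finally have "(\<integral>\<^sup>+x. ennreal (T x powr q) \<partial>M) \<le> ennreal (D powr q / (H * A)) * (ennreal H * ennreal A)"
    by (simp add: mult_left_mono)
  also have "\<dots> = ennreal (D powr q)"
    using H A D by (simp flip: ennreal_mult)
  also have "D powr q = H powr (q / p) * A powr (q / r)"
    using H A by (simp add: D_def powr_mult powr_powr)
  finally show ?thesis .
qed

section \<open>Multiplicative convolution\<close>


text \<open>The invariant measure dx/x of the positive half-line, carried by the whole real line
  with density 0 elsewhere. Integrands thus stay Borel functions on \<open>real\<close>.\<close>

definition haar :: "real measure" where
  "haar = density lborel (\<lambda>x. ennreal (indicator {0<..} x / x))"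

lemma sets_haar [measurable_cong]: "sets haar = sets borel"
  by (simp add: haar_def)

lemma space_haar [simp]: "space haar = UNIV"
  by (simp add: haar_def)

lemma sigma_finite_haar: "sigma_finite_measure haar"
  unfolding haar_def by (subst sigma_finite_measure.sigma_finite_iff_density_finite[OF lborel.sigma_finite_measure_axioms]) auto

lemma nn_integral_haar:
  "F \<in> borel_measurable borel \<Longrightarrow>
    (\<integral>\<^sup>+x. F x \<partial>haar) = (\<integral>\<^sup>+x. ennreal (indicator {0<..} x / x) * F x \<partial>lborel)"
  unfolding haar_def by (subst nn_integral_density) auto

lemma nn_integral_haar_scale:
  assumes [measurable]: "F \<in> borel_measurable borel" and c: "c > 0"
  shows "(\<integral>\<^sup>+x. F (x / c) \<partial>haar) = (\<integral>\<^sup>+u. F u \<partial>haar)"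
proof -
  have "(\<integral>\<^sup>+x. F (x / c) \<partial>haar) = (\<integral>\<^sup>+x. ennreal (indicator {0<..} x / x) * F (x / c) \<partial>lborel)"
    by (rule nn_integral_haar) measurable
  also have "\<dots> = ennreal c * (\<integral>\<^sup>+u. ennreal (indicator {0<..} (0 + c * u) / (0 + c * u)) * F ((0 + c * u) / c) \<partial>lborel)"
    using c by (subst nn_integral_real_affine[of _ c 0]) auto
  also have "\<dots> = (\<integral>\<^sup>+u. ennreal c * (ennreal (indicator {0<..} (0 + c * u) / (0 + c * u)) * F ((0 + c * u) / c)) \<partial>lborel)"
    by (rule nn_integral_cmult[symmetric]) measurable
  also have "\<dots> = (\<integral>\<^sup>+u. ennreal (indicator {0<..} u / u) * F u \<partial>lborel)"
    using c by (intro nn_integral_cong) (auto simp: indicator_def zero_less_mult_iff simp flip: ennreal_mult mult.assoc)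
  also have "\<dots> = (\<integral>\<^sup>+u. F u \<partial>haar)" by (rule nn_integral_haar[symmetric]) measurable
  finally show ?thesis .
qed

lemma nn_integral_abs_powr:
  fixes e c :: real
  assumes "e > -1" "c \<ge> 0"
  shows "(\<integral>\<^sup>+v. ennreal (indicator {-c..c} v * \<bar>v\<bar> powr e) \<partial>lborel) \<le> ennreal (2 * (c powr (e + 1) / (e + 1)))"
proof -
  let ?g = "\<lambda>v. ennreal (indicator {0..c} v * v powr e)"
  have "(\<integral>\<^sup>+v. ennreal (indicator {-c..c} v * \<bar>v\<bar> powr e) \<partial>lborel) \<le> (\<integral>\<^sup>+v. ?g v + ?g (0 + (-1) * v) \<partial>lborel)"
    by (intro nn_integral_mono) (auto simp: indicator_def abs_if)
  also have "\<dots> = (\<integral>\<^sup>+v. ?g v \<partial>lborel) + (\<integral>\<^sup>+v. ?g (0 + (-1) * v) \<partial>lborel)"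
    by (intro nn_integral_add) measurable
  also have "(\<integral>\<^sup>+v. ?g (0 + (-1) * v) \<partial>lborel) = (\<integral>\<^sup>+v. ?g v \<partial>lborel)"
    by (subst (2) nn_integral_real_affine[of _ "-1" 0]) auto
  also have "(\<integral>\<^sup>+v. ?g v \<partial>lborel) = ennreal (c powr (e + 1) / (e + 1))"
    by (intro nn_integral_powr_from_0 assms)
  also have "ennreal (c powr (e + 1) / (e + 1)) + ennreal (c powr (e + 1) / (e + 1)) = ennreal (2 * (c powr (e + 1) / (e + 1)))"
    using assms by (subst ennreal_plus[symmetric]) auto
  finally show ?thesis .
qed

text \<open>Against du/u the integrand behaves like u^(\<beta>r-1) at 0, like
  u^(-(\<delta>-\<beta>)r-1) at infinity and like |1-u|^(-\<theta>r) at 1. The hypotheses are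
  exactly the integrability of these three powers.\<close>

lemma kernel_profile_powr_integrable:
  fixes \<beta> \<delta> \<theta> r :: real
  assumes \<beta>: "0 < \<beta>" "\<beta> < \<delta>" and r: "r > 0" "\<theta> * r < 1"
  obtains A where "A > 0" "(\<integral>\<^sup>+u. ennreal ((u powr \<beta> * kernel_profile \<delta> \<theta> u) powr r) \<partial>haar) \<le> ennreal A"
proof -
  define m where "m = (\<delta> - \<beta>) * r + 1"
  have m: "m > 1" using \<beta> r by (simp add: m_def)
  \<comment> \<open>Bound for u^(\<beta>r)/u on (1/4, 4).\<close>
  define C where "C = 4 powr (\<beta> * r) * 4"
  define A1 A2 A3 where "A1 = (1 / 4) powr (\<beta> * r - 1 + 1) / (\<beta> * r - 1 + 1)"
    and "A2 = 2 * (3 powr (- (\<theta> * r) + 1) / (- (\<theta> * r) + 1))"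
    and "A3 = 4 powr (1 - m) / (m - 1)"
  have br: "\<beta> * r > 0" using \<beta> r by simp
  have An: "A1 > 0" "A2 > 0" "A3 > 0" "C > 0" using br m r by (auto simp: A1_def A2_def A3_def C_def)
  let ?f1 = "\<lambda>u. ennreal (indicator {0..1/4} u * u powr (\<beta> * r - 1))"
  \<comment> \<open>The form \<open>-1 + 1 * u\<close> is that of the affine change of variables
    which later moves the singularity to 0.\<close>
  let ?f2 = "\<lambda>u. ennreal (indicator {-3..3} (-1 + 1 * u) * \<bar>-1 + 1 * u\<bar> powr (- (\<theta> * r)))"
  let ?f3 = "\<lambda>u. ennreal (indicator {4..} u * u powr (- m))"
  show ?thesis
  proof (rule that[of "A1 + C * A2 + A3"])
    show "A1 + C * A2 + A3 > 0" using An by (intro add_pos_pos mult_pos_pos)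
    have pt: "ennreal (indicator {0<..} u / u) * ennreal ((u powr \<beta> * kernel_profile \<delta> \<theta> u) powr r) \<le> ?f1 u + ennreal C * ?f2 u + ?f3 u" for u :: real
    proof (cases "u > 0")
      case u: True
      have split: "(u powr \<beta> * kernel_profile \<delta> \<theta> u) powr r = u powr (\<beta> * r) * kernel_profile \<delta> \<theta> u powr r"
        using u by (simp add: powr_mult powr_powr kernel_profile_nonneg)
      have L: "ennreal (indicator {0<..} u / u) * ennreal ((u powr \<beta> * kernel_profile \<delta> \<theta> u) powr r) =
          ennreal (u powr (\<beta> * r) / u * kernel_profile \<delta> \<theta> u powr r)"
        using u unfolding split by (simp flip: ennreal_mult)
      consider (small) "u \<le> 1 / 4" | (large) "u \<ge> 4" | (mid) "1 / 4 < u" "u < 4" by linarith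
      thus ?thesis
      proof cases
        case small
        have "ennreal (u powr (\<beta> * r) / u * kernel_profile \<delta> \<theta> u powr r) = ?f1 u"
          using small u by (simp add: kernel_profile_def powr_diff)
        thus ?thesis unfolding L by (simp add: add_increasing2)
      next
        case large
        have "- m = \<beta> * r + (- 1) + - (\<delta> * r)" by (simp add: m_def algebra_simps)
        hence "u powr (- m) = u powr (\<beta> * r) * u powr (- 1) * u powr (- (\<delta> * r))"
          by (simp only: powr_add)
        hence "u powr (- m) = u powr (\<beta> * r) / u * u powr (- (\<delta> * r))"
          using u by (simp add: powr_minus divide_inverse)
        hence "ennreal (u powr (\<beta> * r) / u * kernel_profile \<delta> \<theta> u powr r) = ?f3 u"
          using large u by (simp add: kernel_profile_def powr_powr)
        thus ?thesis unfolding L by (simp add: add_increasing)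
      next
        case mid
        have "u powr (\<beta> * r) / u \<le> 4 powr (\<beta> * r) / (1 / 4)"
          using mid br by (intro frac_le powr_mono2) auto
        hence "u powr (\<beta> * r) / u * \<bar>-1 + 1 * u\<bar> powr (- (\<theta> * r)) \<le> C * \<bar>-1 + 1 * u\<bar> powr (- (\<theta> * r))"
          by (intro mult_right_mono) (auto simp: C_def)
        moreover have "kernel_profile \<delta> \<theta> u powr r = \<bar>-1 + 1 * u\<bar> powr (- (\<theta> * r))"
          using mid by (simp add: kernel_profile_def powr_powr abs_minus_commute)
        ultimately have "ennreal (u powr (\<beta> * r) / u * kernel_profile \<delta> \<theta> u powr r) \<le> ennreal C * ?f2 u"
          using mid An by (simp add: ennreal_leI flip: ennreal_mult)
        thus ?thesis unfolding L by (simp add: add_increasing add_increasing2)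
      qed
    qed simp
    have "(\<integral>\<^sup>+u. ennreal ((u powr \<beta> * kernel_profile \<delta> \<theta> u) powr r) \<partial>haar) =
        (\<integral>\<^sup>+u. ennreal (indicator {0<..} u / u) * ennreal ((u powr \<beta> * kernel_profile \<delta> \<theta> u) powr r) \<partial>lborel)"
      by (rule nn_integral_haar) measurable
    also have "\<dots> \<le> (\<integral>\<^sup>+u. ?f1 u + ennreal C * ?f2 u + ?f3 u \<partial>lborel)"
      by (intro nn_integral_mono pt)
    also have "\<dots> = (\<integral>\<^sup>+u. ?f1 u \<partial>lborel) + ennreal C * (\<integral>\<^sup>+u. ?f2 u \<partial>lborel) + (\<integral>\<^sup>+u. ?f3 u \<partial>lborel)"
      by (simp add: nn_integral_add nn_integral_cmult)
    also have "(\<integral>\<^sup>+u. ?f1 u \<partial>lborel) = ennreal A1"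
      unfolding A1_def by (intro nn_integral_powr_from_0) (use br in auto)
    also have "(\<integral>\<^sup>+u. ?f3 u \<partial>lborel) = ennreal A3"
      unfolding A3_def by (intro nn_integral_powr_to_inf m) auto
    also have "(\<integral>\<^sup>+u. ?f2 u \<partial>lborel) = (\<integral>\<^sup>+v. ennreal (indicator {-3..3} v * \<bar>v\<bar> powr (- (\<theta> * r))) \<partial>lborel)"
      by (subst (2) nn_integral_real_affine[of _ 1 "-1"]) auto
    also have "ennreal A1 + ennreal C * \<dots> + ennreal A3 \<le> ennreal A1 + ennreal C * ennreal A2 + ennreal A3"
      unfolding A2_def using r by (intro add_mono mult_left_mono nn_integral_abs_powr order.refl) auto
    also have "\<dots> = ennreal (A1 + C * A2 + A3)"
      using An by (simp add: ennreal_mult)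
    finally show "(\<integral>\<^sup>+u. ennreal ((u powr \<beta> * kernel_profile \<delta> \<theta> u) powr r) \<partial>haar) \<le> ennreal (A1 + C * A2 + A3)" .
  qed
qed

text \<open>Symmetry and homogeneity of degree -\<delta> of the underlying kernel suggest this. The
  two outer pieces of the profile are exchanged exactly. In the middle, |1 - 1/v| = |1 - v|/v
  produces v^\<theta> in place of v^\<delta>, and the constant bounds their quotient for v between
  1/4 and 4.\<close>

lemma kernel_profile_inverse_le:
  fixes \<delta> \<theta> v :: real
  assumes v: "v > 0"
  shows "kernel_profile \<delta> \<theta> (1 / v) \<le> 4 powr \<bar>\<theta> - \<delta>\<bar> * (v powr \<delta> * kernel_profile \<delta> \<theta> v)"
proof -
  have 4: "1 \<le> 4 powr \<bar>\<theta> - \<delta>\<bar>" by (intro ge_one_powr_ge_zero) auto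
  have nonneg: "0 \<le> v powr \<delta> * kernel_profile \<delta> \<theta> v" by (simp add: kernel_profile_nonneg)
  consider (small) "v \<le> 1 / 4" | (large) "v \<ge> 4" | (mid) "1 / 4 < v" "v < 4" by linarith
  thus ?thesis
  proof cases
    case small
    hence "1 / v \<ge> 4" using v by (simp add: field_simps)
    hence "kernel_profile \<delta> \<theta> (1 / v) = v powr \<delta> * kernel_profile \<delta> \<theta> v"
      using small v by (simp add: kernel_profile_def powr_divide powr_minus)
    thus ?thesis using mult_right_mono[OF 4 nonneg] by simp
  next
    case large
    hence "1 / v \<le> 1 / 4" using v by (simp add: field_simps)
    hence "kernel_profile \<delta> \<theta> (1 / v) = v powr \<delta> * kernel_profile \<delta> \<theta> v"
      using large v by (simp add: kernel_profile_def powr_minus)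
    thus ?thesis using mult_right_mono[OF 4 nonneg] by simp
  next
    case mid
    have "1 / v > 1 / 4" "1 / v < 4" using v mid by (simp_all add: field_simps)
    moreover have "\<bar>1 - 1 / v\<bar> = \<bar>1 - v\<bar> / v" using v by (simp add: abs_if field_simps)
    ultimately have "kernel_profile \<delta> \<theta> (1 / v) = v powr \<theta> * \<bar>1 - v\<bar> powr (- \<theta>)"
      using v by (simp add: kernel_profile_def powr_divide powr_minus field_simps)
    also have "v powr \<theta> = v powr (\<theta> - \<delta>) * v powr \<delta>" by (simp flip: powr_add)
    also have "v powr (\<theta> - \<delta>) \<le> 4 powr \<bar>\<theta> - \<delta>\<bar>"
    proof (cases "\<theta> - \<delta> \<ge> 0")
      case True
      thus ?thesis using mid by (auto intro: powr_mono2)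
    next
      case False
      have "v powr (\<theta> - \<delta>) \<le> (1 / 4) powr (\<theta> - \<delta>)" using False mid by (intro powr_mono2') auto
      also have "\<dots> = 4 powr (- (\<theta> - \<delta>))" by (subst powr_minus) (simp add: powr_divide inverse_eq_divide)
      finally show ?thesis using False by simp
    qed
    hence "v powr (\<theta> - \<delta>) * v powr \<delta> * \<bar>1 - v\<bar> powr (- \<theta>) \<le> 4 powr \<bar>\<theta> - \<delta>\<bar> * v powr \<delta> * \<bar>1 - v\<bar> powr (- \<theta>)"
      by (intro mult_right_mono) auto
    finally show ?thesis using mid by (simp add: kernel_profile_def mult.assoc)
  qed
qed

section \<open>The weighted inequality\<close>


lemma borel_measurable_laguerre_frac_int [measurable]:
  "laguerre_frac_int \<alpha> \<sigma> f \<in> borel_measurable borel"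
  unfolding laguerre_frac_int_def laguerre_fun_def laguerre_def by measurable

text \<open>Integration in x is a dilation of the Haar integral. Integration in y involves the
  inverse variable and leads to the same integral with \<beta> replaced by \<delta> - \<beta>, a
  change that preserves 0 < \<beta> < \<delta>.\<close>

lemma profile_kernel_powr_integral_bounds:
  fixes \<beta> \<delta> \<theta> r C :: real
  assumes \<beta>: "0 < \<beta>" "\<beta> < \<delta>" and r: "r > 0" "\<theta> * r < 1" and C: "C \<ge> 0"
  defines "k \<equiv> \<lambda>x y. indicator {0<..} x * (indicator {0<..} y * (C * ((x / y) powr \<beta> * kernel_profile \<delta> \<theta> (x / y))))"
  obtains A where "A > 0" "\<And>y. (\<integral>\<^sup>+x. ennreal (k x y powr r) \<partial>haar) \<le> ennreal A"
    "\<And>x. (\<integral>\<^sup>+y. ennreal (k x y powr r) \<partial>haar) \<le> ennreal A"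
proof -
  define E where "E = 4 powr \<bar>\<theta> - \<delta>\<bar>"
  let ?F = "\<lambda>\<beta> u. (u powr \<beta> * kernel_profile \<delta> \<theta> u) powr r"
  obtain A1 where A1: "A1 > 0" "(\<integral>\<^sup>+u. ennreal (?F \<beta> u) \<partial>haar) \<le> ennreal A1"
    using kernel_profile_powr_integrable[OF \<beta> r] by metis
  have "0 < \<delta> - \<beta>" "\<delta> - \<beta> < \<delta>" using \<beta> by auto
  then obtain A2 where A2: "A2 > 0" "(\<integral>\<^sup>+u. ennreal (?F (\<delta> - \<beta>) u) \<partial>haar) \<le> ennreal A2"
    using kernel_profile_powr_integrable[of "\<delta> - \<beta>" \<delta> r \<theta>] r by metis
  \<comment> \<open>The summand 1 keeps \<open>A\<close> positive also for C = 0.\<close>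
  define A where "A = C powr r * A1 + (C * E) powr r * A2 + 1"
  have E: "E > 0" by (simp add: E_def)
  have A: "C powr r * A1 \<le> A" "(C * E) powr r * A2 \<le> A" "A > 0"
    using A1 A2 by (auto simp: A_def intro!: add_nonneg_pos)
  have scale: "(\<integral>\<^sup>+x. ennreal (c powr r * ?F \<gamma> (x / z)) \<partial>haar) \<le> ennreal A"
    if "z > 0" "c powr r * B \<le> A" "B > 0" "(\<integral>\<^sup>+u. ennreal (?F \<gamma> u) \<partial>haar) \<le> ennreal B" for c z B \<gamma>
  proof -
    have "(\<integral>\<^sup>+x. ennreal (c powr r * ?F \<gamma> (x / z)) \<partial>haar) = (\<integral>\<^sup>+x. ennreal (c powr r) * ennreal (?F \<gamma> (x / z)) \<partial>haar)"
      by (simp add: ennreal_mult)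
    also have "\<dots> = ennreal (c powr r) * (\<integral>\<^sup>+x. ennreal (?F \<gamma> (x / z)) \<partial>haar)"
      by (intro nn_integral_cmult) measurable
    also have "(\<integral>\<^sup>+x. ennreal (?F \<gamma> (x / z)) \<partial>haar) = (\<integral>\<^sup>+u. ennreal (?F \<gamma> u) \<partial>haar)"
      by (rule nn_integral_haar_scale[OF _ that(1)]) measurable
    also have "ennreal (c powr r) * \<dots> \<le> ennreal (c powr r) * ennreal B"
      by (intro mult_left_mono that) auto
    also have "\<dots> = ennreal (c powr r * B)" using that by (simp add: ennreal_mult)
    also have "\<dots> \<le> ennreal A" by (intro ennreal_leI that)
    finally show ?thesis .
  qed
  show ?thesis
  proof (rule that[OF A(3)])
    fix y :: real
    show "(\<integral>\<^sup>+x. ennreal (k x y powr r) \<partial>haar) \<le> ennreal A"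
    proof (cases "y > 0")
      case True
      have "k x y powr r \<le> C powr r * ?F \<beta> (x / y)" for x
        using True C by (auto simp: k_def indicator_def powr_mult kernel_profile_nonneg)
      hence "(\<integral>\<^sup>+x. ennreal (k x y powr r) \<partial>haar) \<le> (\<integral>\<^sup>+x. ennreal (C powr r * ?F \<beta> (x / y)) \<partial>haar)"
        by (intro nn_integral_mono ennreal_leI)
      also have "\<dots> \<le> ennreal A" by (rule scale[OF True A(1) A1])
      finally show ?thesis .
    qed (simp add: k_def)
  next
    fix x :: real
    show "(\<integral>\<^sup>+y. ennreal (k x y powr r) \<partial>haar) \<le> ennreal A"
    proof (cases "x > 0")
      case True
      have "k x y powr r \<le> (C * E) powr r * ?F (\<delta> - \<beta>) (y / x)" for y
      proof (cases "y > 0")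
        case y: True
        define v where "v = y / x"
        have v: "v > 0" "x / y = 1 / v" using True y by (auto simp: v_def)
        have "k x y = C * (v powr (- \<beta>) * kernel_profile \<delta> \<theta> (1 / v))"
          using True y v by (simp add: k_def powr_minus inverse_powr divide_inverse)
        also have "\<dots> \<le> C * (v powr (- \<beta>) * (E * (v powr \<delta> * kernel_profile \<delta> \<theta> v)))"
          unfolding E_def using C by (intro mult_left_mono kernel_profile_inverse_le v) auto
        also have "\<dots> = (C * E) * (v powr (\<delta> - \<beta>) * kernel_profile \<delta> \<theta> v)"
          by (simp add: powr_diff powr_minus divide_inverse)
        finally have "k x y powr r \<le> ((C * E) * (v powr (\<delta> - \<beta>) * kernel_profile \<delta> \<theta> v)) powr r"
          using r C by (intro powr_mono2) (auto simp: k_def kernel_profile_nonneg)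
        also have "\<dots> = (C * E) powr r * ?F (\<delta> - \<beta>) v"
          by (rule powr_mult)
        finally show ?thesis by (simp add: v_def)
      qed (simp add: k_def)
      hence "(\<integral>\<^sup>+y. ennreal (k x y powr r) \<partial>haar) \<le> (\<integral>\<^sup>+y. ennreal ((C * E) powr r * ?F (\<delta> - \<beta>) (y / x)) \<partial>haar)"
        by (intro nn_integral_mono ennreal_leI)
      also have "\<dots> \<le> ennreal A" by (rule scale[OF True A(2) A2])
      finally show ?thesis .
    qed (simp add: k_def)
  qed
qed

text \<open>Passes from integrals to norms. The hypothesis speaks of every H > 0 above the integral,
  not of the integral itself, because the Young estimate divides by H; an integral equal to 0 is
  reached by letting H tend to 0.\<close>

lemma le_mult_Lp_weight_norm:
  fixes A p q c :: real
  assumes pq: "p > 0" "q > 0" and A: "A > 0"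
    and J: "J = (\<integral>\<^sup>+x\<in>{0<..}. ennreal (norm (f x) powr p * x powr c) \<partial>lborel)"
    and J': "J' = (\<integral>\<^sup>+x\<in>{0<..}. ennreal (norm (g x) powr q * x powr d) \<partial>lborel)"
    and bound: "\<And>H. H > 0 \<Longrightarrow> J \<le> ennreal H \<Longrightarrow> J' \<le> ennreal (H powr (q / p) * A powr q)"
  shows "Lp_weight_norm q d g \<le> ennreal A * Lp_weight_norm p c f"
proof (cases J)
  case top
  hence "Lp_weight_norm p c f = \<infinity>" using J by (simp add: Lp_weight_norm_def)
  thus ?thesis using A by (simp add: ennreal_mult_top)
next
  case (real H0)
  have Nf: "Lp_weight_norm p c f = ennreal (H0 powr (1 / p))"
    using real J by (simp add: Lp_weight_norm_def)
  have fin: "J' \<noteq> \<infinity>"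
  proof
    assume "J' = \<infinity>"
    moreover have "J' \<le> ennreal ((H0 + 1) powr (q / p) * A powr q)"
      using real by (intro bound) (auto intro: ennreal_leI)
    ultimately show False by (auto simp: top_unique)
  qed
  hence Ng: "Lp_weight_norm q d g = ennreal (enn2real J' powr (1 / q))"
    using J' by (simp add: Lp_weight_norm_def)
  have *: "enn2real J' powr (1 / q) \<le> A * H powr (1 / p)" if "H > 0" "H0 \<le> H" for H
  proof -
    have "J' \<le> ennreal (H powr (q / p) * A powr q)"
      using real that by (intro bound) (auto intro: ennreal_leI)
    hence "enn2real J' \<le> H powr (q / p) * A powr q"
      by (intro enn2real_leI) auto
    hence "enn2real J' powr (1 / q) \<le> (H powr (q / p) * A powr q) powr (1 / q)"
      using pq by (intro powr_mono2) auto
    also have "\<dots> = A * H powr (1 / p)" using pq A that by (simp add: powr_mult powr_powr)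
    finally show ?thesis .
  qed
  have "enn2real J' powr (1 / q) \<le> A * H0 powr (1 / p)"
  proof (cases "H0 = 0")
    case True
    have "enn2real J' powr (1 / q) \<le> e" if e: "e > 0" for e
    proof -
      have "enn2real J' powr (1 / q) \<le> A * ((e / A) powr p) powr (1 / p)"
        using e A True by (intro *) auto
      also have "\<dots> = e" using e A pq by (simp add: powr_powr)
      finally show ?thesis .
    qed
    hence "enn2real J' powr (1 / q) \<le> 0" by (meson dense_ge)
    thus ?thesis using True by simp
  qed (use * real in auto)
  thus ?thesis unfolding Nf Ng using A by (simp add: ennreal_leI flip: ennreal_mult)
qed

theorem theorem1p1:
  fixes \<alpha> p p' q \<sigma> a b :: real
  assumes "0 \<le> \<alpha>" and "1 < p" and "p \<le> q"
    and "1 / p + 1 / p' = 1"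
    and "0 < \<sigma>" and "\<sigma> < \<alpha> + 1"
    and "a < (\<alpha> + 1) / p'" and "b < (\<alpha> + 1) / q" and "a + b \<ge> 0"
    and "1 / q = 1 / p - (\<sigma> - a - b) / (\<alpha> + 1)"
  shows "\<exists>C::real. 0 \<le> C \<and> (\<forall>f\<in>laguerre_space.
           Lp_weight_norm q (\<alpha> - b * q) (laguerre_frac_int \<alpha> \<sigma> f)
             \<le> ennreal C * Lp_weight_norm p (\<alpha> + a * p) f)"
proof -
  note \<alpha> = assms(1) and p = assms(2) and pq = assms(3) and \<sigma> = assms(5)
  have q: "q > 0" using p pq by simp
  define \<delta> where "\<delta> = \<alpha> + 1 - \<sigma>"
  \<comment> \<open>The exponent for which x^(\<alpha>-bq) dx = (x^\<beta>)^q dx/x.\<close>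
  define \<beta> where "\<beta> = (\<alpha> + 1) / q - b"
  have scaling: "(\<alpha> + 1) / q = (\<alpha> + 1) / p - (\<sigma> - a - b)"
  proof -
    have "(\<alpha> + 1) * (1 / q) = (\<alpha> + 1) * (1 / p) - (\<alpha> + 1) * ((\<sigma> - a - b) / (\<alpha> + 1))"
      unfolding assms(10) by (simp only: right_diff_distrib)
    thus ?thesis using \<alpha> by simp
  qed
  have p': "(\<alpha> + 1) / p' = (\<alpha> + 1) - (\<alpha> + 1) / p"
  proof -
    have "1 / p' = 1 - 1 / p" using assms(4) by simp
    hence "(\<alpha> + 1) * (1 / p') = (\<alpha> + 1) * (1 - 1 / p)" by simp
    thus ?thesis by (simp add: right_diff_distrib)
  qed
  have \<delta>: "\<delta> > 0" using assms(6) by (simp add: \<delta>_def)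
  have \<beta>: "0 < \<beta>" "\<beta> < \<delta>"
    using assms(7,8) scaling unfolding p' \<beta>_def \<delta>_def by linarith+
  define \<iota> where "\<iota> = 1 + 1 / q - 1 / p"
  have \<iota>: "0 < \<iota>" "\<iota> \<le> 1" "1 - \<sigma> \<le> \<iota>"
  proof -
    have "1 / p < 1" "1 / q > 0" using p q by auto
    thus "0 < \<iota>" unfolding \<iota>_def by linarith
    show "\<iota> \<le> 1" unfolding \<iota>_def using p pq by (simp add: frac_le)
    \<comment> \<open>The left side is 1 - \<iota>. The numerator is lowered by a + b >= 0 and the
      denominator is at least 1 by \<alpha> >= 0.\<close>
    have "(\<sigma> - a - b) / (\<alpha> + 1) \<le> \<sigma> / 1"
      using \<alpha> \<sigma> assms(9) by (intro order.trans[OF divide_right_mono[of _ \<sigma>] divide_left_mono]) auto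
    thus "1 - \<sigma> \<le> \<iota>" unfolding \<iota>_def using assms(10) by simp
  qed
  define r where "r = 1 / \<iota>"
  have r: "r \<ge> 1" "1 + 1 / q = 1 / p + 1 / r" using \<iota> by (auto simp: r_def \<iota>_def)
  \<comment> \<open>The strict inequality 1 - 2 \<sigma> < 1 - \<sigma> <= \<iota> is the gap that
    lets the kernel lie in L^r; 1 - 2 \<sigma> < 2 \<delta> amounts to 1 < 2 \<alpha> + 2.\<close>
  have "max 0 (1 - 2 * \<sigma>) < min \<iota> (2 * \<delta>)"
    using \<iota> \<sigma> \<delta> \<alpha> by (auto simp: \<delta>_def)
  then obtain \<theta> where \<theta>: "max 0 (1 - 2 * \<sigma>) < \<theta>" "\<theta> < min \<iota> (2 * \<delta>)" using dense by blast
  have \<theta>r: "\<theta> * r < 1" using \<theta> \<iota> by (simp add: r_def)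
  obtain C0 where C0: "C0 > 0" "\<And>x y. x > 0 \<Longrightarrow> y > 0 \<Longrightarrow> x \<noteq> y \<Longrightarrow>
    frac_kernel \<alpha> \<sigma> x y \<le> ennreal (C0 * y powr (- \<delta>) * kernel_profile \<delta> \<theta> (x / y))"
    using frac_kernel_le_profile[OF \<alpha> \<sigma> \<delta>_def \<delta>, of \<theta>] \<theta> by auto
  define k where "k = (\<lambda>x y. indicator {0<..} x * (indicator {0<..} y * (C0 * ((x / y) powr \<beta> * kernel_profile \<delta> \<theta> (x / y)))))"
  obtain A where A: "A > 0" "\<And>y. (\<integral>\<^sup>+x. ennreal (k x y powr r) \<partial>haar) \<le> ennreal A"
    "\<And>x. (\<integral>\<^sup>+y. ennreal (k x y powr r) \<partial>haar) \<le> ennreal A"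
    unfolding k_def using profile_kernel_powr_integral_bounds[OF \<beta> _ \<theta>r, of C0] r C0 by auto
  have k_meas [measurable]: "(\<lambda>(x, y). k x y) \<in> borel_measurable (haar \<Otimes>\<^sub>M haar)"
    unfolding k_def by measurable
  have k0: "k x y \<ge> 0" for x y using C0 by (simp add: k_def kernel_profile_nonneg)
  show ?thesis
  proof (intro exI[of _ "A powr (1 / r)"] conjI ballI)
    fix f assume f: "f \<in> laguerre_space"
    then obtain P :: "complex poly" where P: "\<And>y. 0 \<le> y \<Longrightarrow> f y = poly P (of_real y) * of_real (exp (- y / 2))"
      unfolding laguerre_space_def by auto
    define g where "g = (\<lambda>y::real. poly P (of_real y) * complex_of_real (exp (- y / 2)))"
    have [measurable]: "g \<in> borel_measurable borel"
      unfolding g_def by (intro borel_measurable_continuous_onI continuous_intros) auto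
    have fg: "f y = g y" if "y > 0" for y using P[of y] that by (simp add: g_def)
    \<comment> \<open>The analogue of \<beta> on the input side: (y^e)^p dy/y = y^(\<alpha>+ap)
      dy.\<close>
    define e where "e = a + (\<alpha> + 1) / p"
    define h where "h = (\<lambda>y. indicator {0<..} y * (y powr e * norm (g y)))"
    define T where "T = (\<lambda>x. indicator {0<..} x * (x powr \<beta> * norm (laguerre_frac_int \<alpha> \<sigma> f x)))"
    have [measurable]: "h \<in> borel_measurable borel" "T \<in> borel_measurable borel"
      unfolding h_def T_def by measurable
    have J: "(\<integral>\<^sup>+y. ennreal (h y powr p) \<partial>haar) = (\<integral>\<^sup>+x\<in>{0<..}. ennreal (norm (f x) powr p * x powr (\<alpha> + a * p)) \<partial>lborel)"
    proof -
      have "e * p = (\<alpha> + a * p) + 1" using p by (simp add: e_def field_simps)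
      hence "ennreal (indicator {0<..} y / y) * ennreal (h y powr p) = ennreal (norm (f y) powr p * y powr (\<alpha> + a * p)) * indicator {0<..} y" for y
        by (cases "y > 0") (auto simp: h_def fg powr_mult powr_powr powr_add simp flip: ennreal_mult)
      thus ?thesis by (subst nn_integral_haar) auto
    qed
    have J': "(\<integral>\<^sup>+x. ennreal (T x powr q) \<partial>haar) = (\<integral>\<^sup>+x\<in>{0<..}. ennreal (norm (laguerre_frac_int \<alpha> \<sigma> f x) powr q * x powr (\<alpha> - b * q)) \<partial>lborel)"
    proof -
      have "\<beta> * q = (\<alpha> - b * q) + 1" using q by (simp add: \<beta>_def field_simps)
      hence "ennreal (indicator {0<..} x / x) * ennreal (T x powr q) = ennreal (norm (laguerre_frac_int \<alpha> \<sigma> f x) powr q * x powr (\<alpha> - b * q)) * indicator {0<..} x" for x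
        by (cases "x > 0") (auto simp: T_def powr_mult powr_powr powr_add simp flip: ennreal_mult)
      thus ?thesis by (subst nn_integral_haar) auto
    qed
    have T_le: "ennreal (T x) \<le> (\<integral>\<^sup>+y. ennreal (k x y * h y) \<partial>haar)" for x
    proof (cases "x > 0")
      case x: True
      \<comment> \<open>This is the scaling relation. The power y^(\<alpha>-\<delta>) splits into
        1/y for the Haar measure, y^(-\<beta>) to complete (x/y)^\<beta>, and y^e inside
        \<open>h\<close>.\<close>
      have exponents: "- \<delta> + \<alpha> = - 1 + - \<beta> + e" using scaling by (simp add: \<delta>_def \<beta>_def e_def)
      have [measurable]: "k x \<in> borel_measurable borel" unfolding k_def by measurable
      have pt: "ennreal (x powr \<beta>) * (frac_kernel \<alpha> \<sigma> x y * ennreal (indicator {0<..} y * (norm (f y) * y powr \<alpha>))) \<le>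
          ennreal (indicator {0<..} y / y) * ennreal (k x y * h y)" if "y \<noteq> x" for y
      proof (cases "y > 0")
        case y: True
        have "ennreal (x powr \<beta>) * (frac_kernel \<alpha> \<sigma> x y * ennreal (indicator {0<..} y * (norm (f y) * y powr \<alpha>))) \<le>
          ennreal (x powr \<beta>) * (ennreal (C0 * y powr (- \<delta>) * kernel_profile \<delta> \<theta> (x / y)) * ennreal (indicator {0<..} y * (norm (f y) * y powr \<alpha>)))"
          using that by (intro mult_left_mono mult_right_mono C0(2) x y) auto
        also have "\<dots> = ennreal (x powr \<beta> * (C0 * y powr (- \<delta>) * kernel_profile \<delta> \<theta> (x / y) * (norm (f y) * y powr \<alpha>)))"
          using C0 y by (simp add: kernel_profile_nonneg flip: ennreal_mult)
        also have "x powr \<beta> * (C0 * y powr (- \<delta>) * kernel_profile \<delta> \<theta> (x / y) * (norm (f y) * y powr \<alpha>)) =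
           x powr \<beta> * (C0 * kernel_profile \<delta> \<theta> (x / y) * norm (f y)) * y powr (- \<delta> + \<alpha>)"
          by (simp only: powr_add mult_ac)
        also have "\<dots> = 1 / y * (k x y * h y)"
          using x y unfolding exponents powr_add by (simp add: k_def h_def fg powr_mult inverse_powr powr_minus divide_inverse)
        finally show ?thesis using y k0[of x y] by (simp add: h_def flip: ennreal_mult)
      qed simp
      have "ennreal (T x) = ennreal (x powr \<beta>) * ennreal (norm (laguerre_frac_int \<alpha> \<sigma> f x))"
        using x by (simp add: T_def ennreal_mult)
      also have "\<dots> \<le> ennreal (x powr \<beta>) * (\<integral>\<^sup>+y. frac_kernel \<alpha> \<sigma> x y * ennreal (indicator {0<..} y * (norm (f y) * y powr \<alpha>)) \<partial>lborel)"
        by (intro mult_left_mono norm_laguerre_frac_int_le \<alpha> \<sigma> f x) auto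
      also have "\<dots> = ennreal (x powr \<beta>) * (\<integral>\<^sup>+y. frac_kernel \<alpha> \<sigma> x y * ennreal (indicator {0<..} y * (norm (g y) * y powr \<alpha>)) \<partial>lborel)"
        by (intro arg_cong2[where f = "(*)"] refl nn_integral_cong) (auto simp: indicator_def fg)
      also have "\<dots> = (\<integral>\<^sup>+y. ennreal (x powr \<beta>) * (frac_kernel \<alpha> \<sigma> x y * ennreal (indicator {0<..} y * (norm (g y) * y powr \<alpha>))) \<partial>lborel)"
        unfolding frac_kernel_def by (intro nn_integral_cmult[symmetric]) measurable
      also have "\<dots> = (\<integral>\<^sup>+y. ennreal (x powr \<beta>) * (frac_kernel \<alpha> \<sigma> x y * ennreal (indicator {0<..} y * (norm (f y) * y powr \<alpha>))) \<partial>lborel)"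
        by (intro nn_integral_cong) (auto simp: indicator_def fg)
      \<comment> \<open>\<open>pt\<close> fails to cover y = x, where the profile takes the value 0;
        that single point is a null set.\<close>
      also have "\<dots> \<le> (\<integral>\<^sup>+y. ennreal (indicator {0<..} y / y) * ennreal (k x y * h y) \<partial>lborel)"
        using AE_lborel_singleton[of x] by (intro nn_integral_mono_AE) (auto elim!: eventually_mono intro: pt)
      also have "\<dots> = (\<integral>\<^sup>+y. ennreal (k x y * h y) \<partial>haar)"
        by (rule nn_integral_haar[symmetric]) measurable
      finally show ?thesis .
    qed (simp add: T_def)
    show "Lp_weight_norm q (\<alpha> - b * q) (laguerre_frac_int \<alpha> \<sigma> f) \<le> ennreal (A powr (1 / r)) * Lp_weight_norm p (\<alpha> + a * p) f"
    proof (rule le_mult_Lp_weight_norm[OF _ q _ J J'])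
      fix H :: real assume H: "H > 0" "(\<integral>\<^sup>+y. ennreal (h y powr p) \<partial>haar) \<le> ennreal H"
      have "(\<integral>\<^sup>+x. ennreal (T x powr q) \<partial>haar) \<le> ennreal (H powr (q / p) * A powr (q / r))"
        by (rule Young_kernel_inequality[OF sigma_finite_haar sigma_finite_haar k_meas _ k0 _ _ _ pq r A(1) H(1) A(3) A(2) H(2) T_le])
           (use p in \<open>auto simp: h_def T_def\<close>)
      thus "(\<integral>\<^sup>+x. ennreal (T x powr q) \<partial>haar) \<le> ennreal (H powr (q / p) * (A powr (1 / r)) powr q)"
        by (simp add: powr_powr)
    qed (use p A in auto)
  qed simp
qed

end
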